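(* Let $R$ be a commutative ring with identity and $M$ a $\mathrm{GV}$-torsion-free $w$-finite type $R$-module. Then $M$ is a $w$-Noetherian module if and only if for every prime $w$-ideal $\mathfrak{p}$ of $R$ with $\mathrm{Ann}(M)\subseteq \mathfrak{p}$, there exists a $w$-finite type submodule $N^{\mathfrak{p}}$ of $M$ such that $\mathfrak{p}M\subseteq N^{\mathfrak{p}}\subseteq M(\mathfrak{p})$.
   Context: All rings are commutative with identity and all modules are unitary. A finitely generated ideal $J$ of $R$ is called a $\mathrm{GV}$-ideal if the natural homomorphism $R\to \mathrm{Hom}_R(J,R)$ (sending $r$ to multiplication by $r$) is an isomorphism; $\mathrm{GV}(R)$ denotes the set of $\mathrm{GV}$-ideals of $R$. For an $R$-module $M$, $\mathrm{tor}_{\mathrm{GV}}(M):=\{x\in M\mid Jx=0 \text{ for some } J\in \mathrm{GV}(R)\}$; $M$ is $\mathrm{GV}$-torsion if $\mathrm{tor}_{\mathrm{GV}}(M)=M$ and $\mathrm{GV}$-torsion-free if $\mathrm{tor}_{\mathrm{GV}}(M)=0$. A $\mathrm{GV}$-torsion-free module $M$ is called a $w$-module if $\mathrm{Ext}^1_R(R/J,M)=0$ for every $J\in \mathrm{GV}(R)$. A $w$-ideal of $R$ is an ideal of $R$ that is a $w$-module; a prime $w$-ideal is a prime ideal that is a $w$-ideal. A maximal $w$-ideal is an ideal maximal among the proper $w$-ideals of $R$ (it is always prime); $w\text{-}\mathrm{Max}(R)$ is the set of these. An $R$-homomorphism $f:M\to N$ is a $w$-epimorphism if $f_{\mathfrak{m}}:M_{\mathfrak{m}}\to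 N_{\mathfrak{m}}$ is surjective for every $\mathfrak{m}\in w\text{-}\mathrm{Max}(R)$, equivalently if $\mathrm{Coker}(f)$ is $\mathrm{GV}$-torsion. An $R$-module $M$ is of $w$-finite type if there exist a finitely generated free module $F$ and a $w$-epimorphism $F\to M$; equivalently, there is a finitely generated submodule $N$ of $M$ such that $M/N$ is $\mathrm{GV}$-torsion. An $R$-module $M$ is $w$-Noetherian if every submodule of $M$ is of $w$-finite type. $\mathrm{Ann}(M)=\{r\in R\mid rM=0\}$. For a prime ideal $\mathfrak{p}$ of $R$, $M(\mathfrak{p}):=\{x\in M\mid sx\in \mathfrak{p}M \text{ for some } s\in R\setminus \mathfrak{p}\}$, which is a submodule of $M$. *)

theory Defs
  imports "HOL-Algebra.Module" "HOL-Algebra.QuotRing"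
begin

text \<open>
  Modules are those of \<^theory>\<open>HOL-Algebra.Module\<close>; the locale \<^const>\<open>module\<close> includes commutativity of
  the ring. A submodule \<open>N\<close> of \<open>M\<close>, regarded as a module, is \<open>M\<lparr>carrier := N\<rparr>\<close>. The record type of modules
  extends that of rings; the fields \<open>mult\<close> and \<open>one\<close> play no role for modules and are left undefined.
\<close>

definition ring_as_module :: "('a, 'b) ring_scheme \<Rightarrow> ('a, 'a) module" where
  "ring_as_module R = \<lparr>carrier = carrier R, mult = undefined, one = undefined,
     zero = \<zero>\<^bsub>R\<^esub>, add = add R, smult = mult R\<rparr>"

definition ideal_as_module :: "('a, 'b) ring_scheme \<Rightarrow> 'a set \<Rightarrow> ('a, 'a) module" where
  "ideal_as_module R I = (ring_as_module R)\<lparr>carrier := I\<rparr>"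

text \<open>As in \<^const>\<open>FactRing\<close>, the elements of the quotient are cosets.\<close>

definition quot_module :: "('a, 'm, 'c) module_scheme \<Rightarrow> 'm set \<Rightarrow> ('a, 'm set) module" where
  "quot_module M H = \<lparr>carrier = a_rcosets\<^bsub>M\<^esub> H, mult = undefined, one = undefined,
     zero = H, add = set_add M,
     smult = (\<lambda>a X. \<Union>x\<in>X. H +>\<^bsub>M\<^esub> (a \<odot>\<^bsub>M\<^esub> x))\<rparr>"

definition Hom_module ::
  "('a, 'b) ring_scheme \<Rightarrow> ('a, 'm, 'c) module_scheme \<Rightarrow> ('a, 'n, 'd) module_scheme \<Rightarrow> ('a, 'm \<Rightarrow> 'n) module" where
  "Hom_module R M N = \<lparr>
     carrier = {f \<in> carrier M \<rightarrow>\<^sub>E carrier N.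
       (\<forall>x\<in>carrier M. \<forall>y\<in>carrier M. f (x \<oplus>\<^bsub>M\<^esub> y) = f x \<oplus>\<^bsub>N\<^esub> f y) \<and>
       (\<forall>a\<in>carrier R. \<forall>x\<in>carrier M. f (a \<odot>\<^bsub>M\<^esub> x) = a \<odot>\<^bsub>N\<^esub> f x)},
     mult = undefined, one = undefined,
     zero = (\<lambda>x\<in>carrier M. \<zero>\<^bsub>N\<^esub>),
     add = (\<lambda>f g. \<lambda>x\<in>carrier M. f x \<oplus>\<^bsub>N\<^esub> g x),
     smult = (\<lambda>a f. \<lambda>x\<in>carrier M. a \<odot>\<^bsub>N\<^esub> f x)\<rparr>"

definition module_iso ::
  "('a, 'b) ring_scheme \<Rightarrow> ('a, 'm, 'c) module_scheme \<Rightarrow> ('a, 'n, 'd) module_scheme \<Rightarrow> ('m \<Rightarrow> 'n) set" where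
  "module_iso R M N = {f \<in> carrier (Hom_module R M N). bij_betw f (carrier M) (carrier N)}"

definition free_module :: "('a, 'b) ring_scheme \<Rightarrow> 'x set \<Rightarrow> ('a, 'x \<Rightarrow> 'a) module" where
  "free_module R X = \<lparr>
     carrier = {f \<in> X \<rightarrow>\<^sub>E carrier R. finite {x \<in> X. f x \<noteq> \<zero>\<^bsub>R\<^esub>}},
     mult = undefined, one = undefined,
     zero = (\<lambda>x\<in>X. \<zero>\<^bsub>R\<^esub>),
     add = (\<lambda>f g. \<lambda>x\<in>X. f x \<oplus>\<^bsub>R\<^esub> g x),
     smult = (\<lambda>a f. \<lambda>x\<in>X. a \<otimes>\<^bsub>R\<^esub> f x)\<rparr>"


text \<open>
  \<open>Ext\<^sup>1(N, M)\<close> is the first cohomology of \<open>Hom(F\<^sub>\<bullet>, M)\<close>, where \<open>F\<^sub>2 \<rightarrow> F\<^sub>1 \<rightarrow> F\<^sub>0 \<rightarrow> N \<rightarrow> 0\<close> is the beginning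
  of the canonical free resolution of \<open>N\<close>: \<open>F\<^sub>0\<close> is free on the elements of \<open>N\<close>, \<open>F\<^sub>1\<close> is free on the
  elements of the kernel of \<open>F\<^sub>0 \<rightarrow> N\<close>, and so on.
\<close>

definition free_cover :: "('a, 'b) ring_scheme \<Rightarrow> ('a, 'n, 'c) module_scheme \<Rightarrow> ('n \<Rightarrow> 'a) \<Rightarrow> 'n" where
  "free_cover R N f = (\<Oplus>\<^bsub>N\<^esub>x\<in>{x \<in> carrier N. f x \<noteq> \<zero>\<^bsub>R\<^esub>}. f x \<odot>\<^bsub>N\<^esub> x)"

definition syzygy :: "('a, 'b) ring_scheme \<Rightarrow> ('a, 'n, 'c) module_scheme \<Rightarrow> ('a, 'n \<Rightarrow> 'a) module" where
  "syzygy R N = (free_module R (carrier N))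
     \<lparr>carrier := a_kernel (free_module R (carrier N)) N (free_cover R N)\<rparr>"

definition Ext1 ::
  "('a, 'b) ring_scheme \<Rightarrow> ('a, 'n, 'c) module_scheme \<Rightarrow> ('a, 'm, 'd) module_scheme
     \<Rightarrow> ('a, ((('n \<Rightarrow> 'a) \<Rightarrow> 'a) \<Rightarrow> 'm) set) module" where
  "Ext1 R N M =
    (let K\<^sub>1 = syzygy R N; K\<^sub>2 = syzygy R K\<^sub>1;
         F\<^sub>0 = free_module R (carrier N);
         F\<^sub>1 = free_module R (carrier K\<^sub>1);
         F\<^sub>2 = free_module R (carrier K\<^sub>2);
         d\<^sub>1 = free_cover R K\<^sub>1;
         d\<^sub>2 = free_cover R K\<^sub>2;
         Z = {\<phi> \<in> carrier (Hom_module R F\<^sub>1 M). \<forall>z\<in>carrier F\<^sub>2. \<phi> (d\<^sub>2 z) = \<zero>\<^bsub>M\<^esub>};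
         B = (\<lambda>\<psi>. compose (carrier F\<^sub>1) \<psi> d\<^sub>1) ` carrier (Hom_module R F\<^sub>0 M)
     in quot_module ((Hom_module R F\<^sub>1 M)\<lparr>carrier := Z\<rparr>) B)"


definition GV_ideal :: "('a, 'b) ring_scheme \<Rightarrow> 'a set \<Rightarrow> bool" where
  "GV_ideal R J \<longleftrightarrow>
     (\<exists>S. finite S \<and> S \<subseteq> carrier R \<and> J = Idl\<^bsub>R\<^esub> S) \<and>
     (\<lambda>r\<in>carrier R. \<lambda>x\<in>J. r \<otimes>\<^bsub>R\<^esub> x)
       \<in> module_iso R (ring_as_module R) (Hom_module R (ideal_as_module R J) (ring_as_module R))"

definition tor_GV :: "('a, 'b) ring_scheme \<Rightarrow> ('a, 'm, 'c) module_scheme \<Rightarrow> 'm set" where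
  "tor_GV R M = {x \<in> carrier M. \<exists>J. GV_ideal R J \<and> (\<forall>a\<in>J. a \<odot>\<^bsub>M\<^esub> x = \<zero>\<^bsub>M\<^esub>)}"

definition GV_torsion_free :: "('a, 'b) ring_scheme \<Rightarrow> ('a, 'm, 'c) module_scheme \<Rightarrow> bool" where
  "GV_torsion_free R M \<longleftrightarrow> tor_GV R M = {\<zero>\<^bsub>M\<^esub>}"

definition w_module :: "('a, 'b) ring_scheme \<Rightarrow> ('a, 'm, 'c) module_scheme \<Rightarrow> bool" where
  "w_module R M \<longleftrightarrow> GV_torsion_free R M \<and>
     (\<forall>J. GV_ideal R J \<longrightarrow>
        (let E = Ext1 R (quot_module (ring_as_module R) J) M in carrier E = {\<zero>\<^bsub>E\<^esub>}))"

definition w_ideal :: "('a, 'b) ring_scheme \<Rightarrow> 'a set \<Rightarrow> bool" where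
  "w_ideal R I \<longleftrightarrow> ideal I R \<and> w_module R (ideal_as_module R I)"

definition prime_w_ideal :: "('a, 'b) ring_scheme \<Rightarrow> 'a set \<Rightarrow> bool" where
  "prime_w_ideal R \<pp> \<longleftrightarrow> primeideal \<pp> R \<and> w_ideal R \<pp>"

definition w_Max :: "('a, 'b) ring_scheme \<Rightarrow> 'a set set" where
  "w_Max R = {\<mm>. w_ideal R \<mm> \<and> \<mm> \<noteq> carrier R \<and>
     (\<forall>I. w_ideal R I \<and> I \<noteq> carrier R \<and> \<mm> \<subseteq> I \<longrightarrow> I = \<mm>)}"


text \<open>
  \<open>local_rel R M \<pp>\<close> relates the numerator/denominator pairs that represent the same fraction in the
  localization \<open>M\<^sub>\<pp>\<close>. Only the underlying set of \<open>M\<^sub>\<pp>\<close> is needed, since surjectivity of \<open>f\<^sub>\<pp>\<close> does not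
  involve the operations.
\<close>

definition local_rel ::
  "('a, 'b) ring_scheme \<Rightarrow> ('a, 'm, 'c) module_scheme \<Rightarrow> 'a set \<Rightarrow> (('m \<times> 'a) \<times> ('m \<times> 'a)) set" where
  "local_rel R M \<pp> = {((x, s), (y, t)).
     x \<in> carrier M \<and> y \<in> carrier M \<and> s \<in> carrier R - \<pp> \<and> t \<in> carrier R - \<pp> \<and>
     (\<exists>u\<in>carrier R - \<pp>. u \<odot>\<^bsub>M\<^esub> (t \<odot>\<^bsub>M\<^esub> x) = u \<odot>\<^bsub>M\<^esub> (s \<odot>\<^bsub>M\<^esub> y))}"

definition localization ::
  "('a, 'b) ring_scheme \<Rightarrow> ('a, 'm, 'c) module_scheme \<Rightarrow> 'a set \<Rightarrow> ('m \<times> 'a) set set" where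
  "localization R M \<pp> = (carrier M \<times> (carrier R - \<pp>)) // local_rel R M \<pp>"

text \<open>\<open>f\<^sub>\<pp>\<close> sends the class of \<open>(x, s)\<close> to the class of \<open>(f x, s)\<close>; the union over the representatives
  of a class is over equal sets.\<close>

definition local_map ::
  "('a, 'b) ring_scheme \<Rightarrow> ('a, 'n, 'd) module_scheme \<Rightarrow> 'a set \<Rightarrow> ('m \<Rightarrow> 'n)
     \<Rightarrow> ('m \<times> 'a) set \<Rightarrow> ('n \<times> 'a) set" where
  "local_map R N \<pp> f X = (\<Union>(x, s)\<in>X. local_rel R N \<pp> `` {(f x, s)})"

definition w_epi ::
  "('a, 'b) ring_scheme \<Rightarrow> ('a, 'm, 'c) module_scheme \<Rightarrow> ('a, 'n, 'd) module_scheme \<Rightarrow> ('m \<Rightarrow> 'n) \<Rightarrow> bool" where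
  "w_epi R M N f \<longleftrightarrow> f \<in> carrier (Hom_module R M N) \<and>
     (\<forall>\<mm>\<in>w_Max R. local_map R N \<mm> f ` localization R M \<mm> = localization R N \<mm>)"

definition w_finite_type :: "('a, 'b) ring_scheme \<Rightarrow> ('a, 'm, 'c) module_scheme \<Rightarrow> bool" where
  "w_finite_type R M \<longleftrightarrow> (\<exists>(n::nat) f. w_epi R (free_module R {..<n}) M f)"

definition w_Noetherian :: "('a, 'b) ring_scheme \<Rightarrow> ('a, 'm, 'c) module_scheme \<Rightarrow> bool" where
  "w_Noetherian R M \<longleftrightarrow> (\<forall>N. submodule N R M \<longrightarrow> w_finite_type R (M\<lparr>carrier := N\<rparr>))"

definition Ann :: "('a, 'b) ring_scheme \<Rightarrow> ('a, 'm, 'c) module_scheme \<Rightarrow> 'a set" where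
  "Ann R M = {r \<in> carrier R. \<forall>x\<in>carrier M. r \<odot>\<^bsub>M\<^esub> x = \<zero>\<^bsub>M\<^esub>}"

definition ideal_smult ::
  "('a, 'b) ring_scheme \<Rightarrow> 'a set \<Rightarrow> ('a, 'm, 'c) module_scheme \<Rightarrow> 'm set" where
  "ideal_smult R I M = \<Inter>{N. submodule N R M \<and> (\<forall>a\<in>I. \<forall>x\<in>carrier M. a \<odot>\<^bsub>M\<^esub> x \<in> N)}"

text \<open>\<open>M(\<pp>)\<close>, not to be confused with the localization \<open>M\<^sub>\<pp>\<close>.\<close>

definition prime_saturation ::
  "('a, 'b) ring_scheme \<Rightarrow> ('a, 'm, 'c) module_scheme \<Rightarrow> 'a set \<Rightarrow> 'm set" where
  "prime_saturation R M \<pp> =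
     {x \<in> carrier M. \<exists>s\<in>carrier R - \<pp>. s \<odot>\<^bsub>M\<^esub> x \<in> ideal_smult R \<pp> M}"

end

theory Submission
  imports Defs
begin

text \<open>
  The proof is Cohen's argument carried out modulo \<open>GV\<close>-torsion. For a submodule \<open>T\<close> of \<open>M\<close> let \<open>T\<^sub>w\<close> be
  the set of all \<open>x \<in> M\<close> with \<open>J x \<subseteq> T\<close> for some \<open>GV\<close>-ideal \<open>J\<close> (\<open>GV_closure\<close>); since products of
  \<open>GV\<close>-ideals are \<open>GV\<close>-ideals, this is a closure operator. A submodule \<open>N\<close> is of \<open>w\<close>-finite type iff it
  contains a finite set \<open>S\<close> whose span is dense in it, \<open>N \<subseteq> \<langle>S\<rangle>\<^sub>w\<close> (\<open>w_finite_type_iff\<close>).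

  If \<open>M\<close> is \<open>w\<close>-Noetherian, \<open>\<pp>M\<close> itself serves as the required submodule. Conversely, suppose that some
  submodule is not of \<open>w\<close>-finite type. A finite set inside the union of a chain lies in one member, so a
  union of such submodules is again such a submodule, and Zorn's lemma gives a maximal one, \<open>N\<close>. What drives
  the rest is \<open>maximal_absorbs\<close>: if \<open>N \<inter> L\<close> lies in the closure of the span of a finite subset of \<open>N\<close>,
  then \<open>L \<subseteq> N\<close>. For otherwise \<open>N + L\<close> is of \<open>w\<close>-finite type by maximality; splitting its generators as
  \<open>n + l\<close>, the parts \<open>n\<close> together with that finite subset generate \<open>N\<close> up to closure. It is applied to
  three submodules \<open>L\<close>:

  \<^item> \<open>L = Rx\<close> with \<open>x \<in> N\<^sub>w\<close>, which gives \<open>N\<^sub>w = N\<close>;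
  \<^item> \<open>L = aM\<close>, which gives that either \<open>aM \<subseteq> N\<close> or \<open>a x \<in> N\<close> implies \<open>x \<in> N\<close>. Therefore
    \<open>\<pp> = (N : M)\<close> is prime, and it is a \<open>w\<close>-ideal because \<open>N\<close> is closed;
  \<^item> \<open>L = Rx\<close> with \<open>x \<notin> N\<close>. If \<open>P\<close> is the submodule given for this \<open>\<pp>\<close>, then \<open>\<pp>M \<subseteq> P \<subseteq> M(\<pp>) \<subseteq> N\<close> and
    \<open>N \<inter> Rx \<subseteq> \<pp>x \<subseteq> P\<close>, so the finitely many generators of \<open>P\<close> force \<open>x \<in> N\<close>, a contradiction.

  Two descriptions connect this with the definitions. First, \<open>Ext\<^sup>1(R/J, A) = 0\<close> means that every linear map
  \<open>J \<rightarrow> A\<close> is \<open>j \<mapsto> j y\<close> for some \<open>y \<in> A\<close> (\<open>Ext1_cyclic_trivial_iff\<close>); hence an ideal is a \<open>w\<close>-ideal iff it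
  equals its closure (\<open>w_ideal_iff\<close>). Secondly, an ideal that contains no \<open>GV\<close>-ideal lies in a maximal
  \<open>w\<close>-ideal, and maximal \<open>w\<close>-ideals are prime; hence a map is a \<open>w\<close>-epimorphism iff the closure of its image
  is everything (\<open>w_epi_iff\<close>).
\<close>

section \<open>Linear maps\<close>

text \<open>Unlike membership in \<^const>\<open>Hom_module\<close> this does not prescribe the values outside the carrier, so sums
  and composites of linear maps are linear as they stand.\<close>

definition linear_map ::
  "('a, 'b) ring_scheme \<Rightarrow> ('a, 'm, 'c) module_scheme \<Rightarrow> ('a, 'n, 'd) module_scheme \<Rightarrow> ('m \<Rightarrow> 'n) \<Rightarrow> bool" where
  "linear_map R A B f \<longleftrightarrow> f \<in> carrier A \<rightarrow> carrier B \<and>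
     (\<forall>x\<in>carrier A. \<forall>y\<in>carrier A. f (x \<oplus>\<^bsub>A\<^esub> y) = f x \<oplus>\<^bsub>B\<^esub> f y) \<and>
     (\<forall>a\<in>carrier R. \<forall>x\<in>carrier A. f (a \<odot>\<^bsub>A\<^esub> x) = a \<odot>\<^bsub>B\<^esub> f x)"

lemma linear_mapI:
  assumes "\<And>x. x \<in> carrier A \<Longrightarrow> f x \<in> carrier B"
    and "\<And>x y. x \<in> carrier A \<Longrightarrow> y \<in> carrier A \<Longrightarrow> f (x \<oplus>\<^bsub>A\<^esub> y) = f x \<oplus>\<^bsub>B\<^esub> f y"
    and "\<And>a x. a \<in> carrier R \<Longrightarrow> x \<in> carrier A \<Longrightarrow> f (a \<odot>\<^bsub>A\<^esub> x) = a \<odot>\<^bsub>B\<^esub> f x"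
  shows "linear_map R A B f"
  using assms unfolding linear_map_def by auto

lemma linear_mapD:
  assumes "linear_map R A B f"
  shows "\<And>x. x \<in> carrier A \<Longrightarrow> f x \<in> carrier B"
    and "\<And>x y. x \<in> carrier A \<Longrightarrow> y \<in> carrier A \<Longrightarrow> f (x \<oplus>\<^bsub>A\<^esub> y) = f x \<oplus>\<^bsub>B\<^esub> f y"
    and "\<And>a x. a \<in> carrier R \<Longrightarrow> x \<in> carrier A \<Longrightarrow> f (a \<odot>\<^bsub>A\<^esub> x) = a \<odot>\<^bsub>B\<^esub> f x"
  using assms unfolding linear_map_def by auto

lemma Hom_module_iff:
  "f \<in> carrier (Hom_module R A B) \<longleftrightarrow> linear_map R A B f \<and> f \<in> extensional (carrier A)"
  unfolding Hom_module_def linear_map_def PiE_def by auto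

lemma linear_map_cong:
  assumes A: "module R A" and f: "linear_map R A B f"
    and eq: "\<And>x. x \<in> carrier A \<Longrightarrow> g x = f x"
  shows "linear_map R A B g"
proof -
  interpret A: module R A by fact
  show ?thesis
    using eq linear_mapD[OF f] by (intro linear_mapI) auto
qed

lemma restrict_in_Hom_module:
  assumes "module R A" and "linear_map R A B f"
  shows "restrict f (carrier A) \<in> carrier (Hom_module R A B)"
  using linear_map_cong[OF assms] by (simp add: Hom_module_iff)

lemma linear_map_comp:
  assumes f: "linear_map R A B f" and g: "linear_map R B C g"
  shows "linear_map R A C (\<lambda>x. g (f x))"
  by (intro linear_mapI) (simp_all add: linear_mapD[OF f] linear_mapD[OF g])

lemma linear_map_zero:
  assumes A: "module R A" and B: "module R B" and f: "linear_map R A B f"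
  shows "f \<zero>\<^bsub>A\<^esub> = \<zero>\<^bsub>B\<^esub>"
proof -
  interpret A: module R A by fact
  interpret B: module R B by fact
  have "f \<zero>\<^bsub>A\<^esub> = f (\<zero>\<^bsub>R\<^esub> \<odot>\<^bsub>A\<^esub> \<zero>\<^bsub>A\<^esub>)" by simp
  also have "\<dots> = \<zero>\<^bsub>R\<^esub> \<odot>\<^bsub>B\<^esub> f \<zero>\<^bsub>A\<^esub>" by (rule linear_mapD(3)[OF f]) auto
  also have "\<dots> = \<zero>\<^bsub>B\<^esub>" by (simp add: linear_mapD(1)[OF f])
  finally show ?thesis .
qed

lemma linear_map_uminus:
  assumes A: "module R A" and B: "module R B" and f: "linear_map R A B f" and x: "x \<in> carrier A"
  shows "f (\<ominus>\<^bsub>A\<^esub> x) = \<ominus>\<^bsub>B\<^esub> f x"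
proof -
  interpret A: module R A by fact
  interpret B: module R B by fact
  have "f (\<ominus>\<^bsub>A\<^esub> x) = f ((\<ominus>\<^bsub>R\<^esub> \<one>\<^bsub>R\<^esub>) \<odot>\<^bsub>A\<^esub> x)" using x by (simp add: A.smult_l_minus)
  also have "\<dots> = (\<ominus>\<^bsub>R\<^esub> \<one>\<^bsub>R\<^esub>) \<odot>\<^bsub>B\<^esub> f x" by (rule linear_mapD(3)[OF f]) (use x in auto)
  also have "\<dots> = \<ominus>\<^bsub>B\<^esub> f x" using x by (simp add: B.smult_l_minus linear_mapD(1)[OF f])
  finally show ?thesis .
qed

lemma linear_map_minus:
  assumes A: "module R A" and B: "module R B" and f: "linear_map R A B f"
    and x: "x \<in> carrier A" and y: "y \<in> carrier A"
  shows "f (x \<ominus>\<^bsub>A\<^esub> y) = f x \<ominus>\<^bsub>B\<^esub> f y"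
proof -
  interpret A: module R A by fact
  show ?thesis
    using x y by (simp add: a_minus_def linear_mapD(2)[OF f] linear_map_uminus[OF A B f])
qed

text \<open>Closure under negation comes for free, as \<open>-x = (-1)x\<close>.\<close>

lemma (in module) submoduleI':
  assumes "H \<subseteq> carrier M" and "\<zero>\<^bsub>M\<^esub> \<in> H"
    and "\<And>x y. x \<in> H \<Longrightarrow> y \<in> H \<Longrightarrow> x \<oplus>\<^bsub>M\<^esub> y \<in> H"
    and smult: "\<And>a x. a \<in> carrier R \<Longrightarrow> x \<in> H \<Longrightarrow> a \<odot>\<^bsub>M\<^esub> x \<in> H"
  shows "submodule H R M"
proof (rule submoduleI)
  fix x assume "x \<in> H"
  then show "\<ominus>\<^bsub>M\<^esub> x \<in> H"
    using smult[of "\<ominus> \<one>" x] assms(1) by (auto simp: smult_l_minus subset_iff)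
qed (use assms in auto)

lemma (in module) submodule_zero: "submodule H R M \<Longrightarrow> \<zero>\<^bsub>M\<^esub> \<in> H"
  using subgroup.one_closed[OF submodule.axioms(1)] by fastforce

lemma (in module) submodule_minus:
  "submodule H R M \<Longrightarrow> x \<in> H \<Longrightarrow> y \<in> H \<Longrightarrow> x \<ominus>\<^bsub>M\<^esub> y \<in> H"
  by (simp add: a_minus_def submoduleE)

lemma submodule_vimage:
  assumes A: "module R A" and B: "module R B" and f: "linear_map R A B f" and N: "submodule N R B"
  shows "submodule {x \<in> carrier A. f x \<in> N} R A"
proof -
  interpret A: module R A by fact
  interpret B: module R B by fact
  show ?thesis
    using B.submoduleE[OF N] B.submodule_zero[OF N] linear_map_zero[OF A B f]
    by (intro A.submoduleI') (auto simp: linear_mapD[OF f])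
qed

lemma submodule_image:
  assumes A: "module R A" and B: "module R B" and f: "linear_map R A B f" and N: "submodule N R A"
  shows "submodule (f ` N) R B"
proof -
  interpret A: module R A by fact
  interpret B: module R B by fact
  note N' = A.submoduleE[OF N] A.submodule_zero[OF N]
  show ?thesis
  proof (rule B.submoduleI')
    show "f ` N \<subseteq> carrier B" using N'(1) linear_mapD(1)[OF f] by auto
    show "\<zero>\<^bsub>B\<^esub> \<in> f ` N" using A.submodule_zero[OF N] linear_map_zero[OF A B f] by force
    fix x y assume "x \<in> f ` N" "y \<in> f ` N"
    then obtain u v where uv: "u \<in> N" "x = f u" "v \<in> N" "y = f v" by auto
    then have "x \<oplus>\<^bsub>B\<^esub> y = f (u \<oplus>\<^bsub>A\<^esub> v)" using N'(1) by (auto simp: linear_mapD(2)[OF f] subset_iff)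
    with uv show "x \<oplus>\<^bsub>B\<^esub> y \<in> f ` N" by (simp add: N'(5))
  next
    fix a x assume a: "a \<in> carrier R" and "x \<in> f ` N"
    then obtain u where u: "u \<in> N" "x = f u" by auto
    then have "a \<odot>\<^bsub>B\<^esub> x = f (a \<odot>\<^bsub>A\<^esub> u)" using N'(1) a by (auto simp: linear_mapD(3)[OF f] subset_iff)
    with u a show "a \<odot>\<^bsub>B\<^esub> x \<in> f ` N" by (simp add: N'(4))
  qed
qed

lemma submodule_equalizer:
  assumes A: "module R A" and B: "module R B" and f: "linear_map R A B f" and g: "linear_map R A B g"
  shows "submodule {x \<in> carrier A. f x = g x} R A"
proof -
  interpret A: module R A by fact
  interpret B: module R B by fact
  show ?thesis
    using linear_map_zero[OF A B f] linear_map_zero[OF A B g]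
    by (intro A.submoduleI') (auto simp: linear_mapD[OF f] linear_mapD[OF g])
qed

lemma (in module) submodule_Inter:
  assumes "\<And>N. N \<in> \<N> \<Longrightarrow> submodule N R M" and "\<N> \<noteq> {}"
  shows "submodule (\<Inter>\<N>) R M"
proof (rule submoduleI')
  show "\<Inter>\<N> \<subseteq> carrier M" using assms submoduleE(1) by blast
  show "\<zero>\<^bsub>M\<^esub> \<in> \<Inter>\<N>" using assms submodule_zero by blast
  show "x \<oplus>\<^bsub>M\<^esub> y \<in> \<Inter>\<N>" if "x \<in> \<Inter>\<N>" "y \<in> \<Inter>\<N>" for x y
    using that assms submoduleE(5) by blast
  show "a \<odot>\<^bsub>M\<^esub> x \<in> \<Inter>\<N>" if "a \<in> carrier R" "x \<in> \<Inter>\<N>" for a x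
    using that assms submoduleE(4) by blast
qed

lemma (in module) smult_linear:
  assumes a: "a \<in> carrier R"
  shows "linear_map R M M (\<lambda>x. a \<odot>\<^bsub>M\<^esub> x)"
proof (rule linear_mapI)
  fix b x assume "b \<in> carrier R" "x \<in> carrier M"
  then show "a \<odot>\<^bsub>M\<^esub> (b \<odot>\<^bsub>M\<^esub> x) = b \<odot>\<^bsub>M\<^esub> (a \<odot>\<^bsub>M\<^esub> x)"
    using a by (metis smult_assoc1 R.m_comm)
qed (use a smult_r_distr in auto)

section \<open>The ring as a module, ideals and quotient modules\<close>

lemma ring_as_module_simps [simp]:
  "carrier (ring_as_module R) = carrier R" "zero (ring_as_module R) = zero R"
  "add (ring_as_module R) = add R" "smult (ring_as_module R) = mult R"
  by (simp_all add: ring_as_module_def)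

lemma a_inv_ring_as_module [simp]: "a_inv (ring_as_module R) = a_inv R"
  by (simp add: a_inv_def m_inv_def fun_eq_iff)

lemma ideal_as_module_simps [simp]:
  "carrier (ideal_as_module R I) = I" "zero (ideal_as_module R I) = zero R"
  "add (ideal_as_module R I) = add R" "smult (ideal_as_module R I) = mult R"
  by (simp_all add: ideal_as_module_def)

lemma (in cring) ring_as_module_module: "module R (ring_as_module R)"
proof (rule moduleI)
  show "cring R" by (rule is_cring)
  show "abelian_group (ring_as_module R)"
  proof (rule abelian_groupI)
    fix x assume "x \<in> carrier (ring_as_module R)"
    then show "\<exists>y\<in>carrier (ring_as_module R). y \<oplus>\<^bsub>ring_as_module R\<^esub> x = \<zero>\<^bsub>ring_as_module R\<^esub>"
      by (intro bexI[of _ "\<ominus> x"]) (simp_all add: l_neg)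
  qed (simp_all add: a_ac)
qed (auto simp: l_distr r_distr m_assoc)

text \<open>Through this lemma closures and colon ideals in \<open>R\<close> become instances of the facts about submodules.\<close>

lemma (in cring) submodule_ring_as_module_iff:
  "submodule I R (ring_as_module R) \<longleftrightarrow> ideal I R"
proof
  interpret RM: module R "ring_as_module R" by (rule ring_as_module_module)
  assume I: "submodule I R (ring_as_module R)"
  note I' = RM.submoduleE[OF I, simplified]
  show "ideal I R"
  proof (rule idealI)
    show "ring R" by (rule ring_axioms)
    show "subgroup I (add_monoid R)"
      using submodule.axioms(1)[OF I] by (simp add: subgroup_def m_inv_def)
    fix a x assume "a \<in> I" "x \<in> carrier R"
    then show "x \<otimes> a \<in> I" "a \<otimes> x \<in> I" using I'(1,4) m_comm by fastforce+
  qed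
next
  interpret RM: module R "ring_as_module R" by (rule ring_as_module_module)
  assume I: "ideal I R"
  then interpret I: ideal I R .
  show "submodule I R (ring_as_module R)"
    using I.a_subset I.a_closed I.zero_closed I.I_l_closed
    by (intro RM.submoduleI') auto
qed

lemma (in cring) ideal_as_module_module:
  assumes "ideal I R"
  shows "module R (ideal_as_module R I)"
  using submodule.submodule_is_module[OF _ ring_as_module_module] assms
  by (simp add: submodule_ring_as_module_iff ideal_as_module_def)

lemma (in module) smult_right_linear:
  assumes "x \<in> carrier M"
  shows "linear_map R (ring_as_module R) M (\<lambda>a. a \<odot>\<^bsub>M\<^esub> x)"
  using assms by (intro linear_mapI) (auto simp: smult_l_distr smult_assoc1)

context module
begin

lemma submodule_abelian_subgroup:
  assumes "submodule H R M"
  shows "abelian_subgroup H M"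
  by (rule abelian_subgroupI3)
     (simp_all add: additive_subgroupI submodule.axioms(1)[OF assms] M.abelian_group_axioms)

lemma quot_module_simps:
  "carrier (quot_module M H) = a_rcosets\<^bsub>M\<^esub> H" "zero (quot_module M H) = H"
  "add (quot_module M H) = set_add M"
  by (simp_all add: quot_module_def)

lemma quot_module_coset_iff:
  assumes H: "submodule H R M" and "x \<in> carrier M" "y \<in> carrier M"
  shows "H +>\<^bsub>M\<^esub> x = H +>\<^bsub>M\<^esub> y \<longleftrightarrow> x \<ominus>\<^bsub>M\<^esub> y \<in> H"
proof -
  interpret H: abelian_subgroup H M by (rule submodule_abelian_subgroup[OF H])
  show ?thesis
    using assms(2,3) H.a_rcos_module[of y x] H.a_repr_independence'[of x y]
      H.a_repr_independenceD[of x y] unfolding a_minus_def by metis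
qed

text \<open>The scalar multiplication of the quotient is a union over all representatives of the coset; they all
  contribute the same coset.\<close>

lemma quot_module_smult_coset:
  assumes H: "submodule H R M" and a: "a \<in> carrier R" and x: "x \<in> carrier M"
  shows "a \<odot>\<^bsub>quot_module M H\<^esub> (H +>\<^bsub>M\<^esub> x) = H +>\<^bsub>M\<^esub> (a \<odot>\<^bsub>M\<^esub> x)"
proof -
  interpret H: abelian_subgroup H M by (rule submodule_abelian_subgroup[OF H])
  have "H +>\<^bsub>M\<^esub> (a \<odot>\<^bsub>M\<^esub> y) = H +>\<^bsub>M\<^esub> (a \<odot>\<^bsub>M\<^esub> x)" if y: "y \<in> H +>\<^bsub>M\<^esub> x" for y
  proof -
    have yM: "y \<in> carrier M" using y x H.a_elemrcos_carrier by blast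
    have "y \<ominus>\<^bsub>M\<^esub> x \<in> H" using H.a_rcos_module[OF x yM] y unfolding a_minus_def by simp
    then have "a \<odot>\<^bsub>M\<^esub> (y \<ominus>\<^bsub>M\<^esub> x) \<in> H" using submoduleE(4)[OF H] a by blast
    then have "a \<odot>\<^bsub>M\<^esub> y \<ominus>\<^bsub>M\<^esub> a \<odot>\<^bsub>M\<^esub> x \<in> H"
      using linear_map_minus[OF _ _ smult_linear[OF a] yM x] module_axioms by simp
    then show ?thesis using quot_module_coset_iff[OF H] a x yM by simp
  qed
  moreover have "x \<in> H +>\<^bsub>M\<^esub> x" using H.a_rcos_self x by blast
  ultimately have "(\<Union>y\<in>H +>\<^bsub>M\<^esub> x. H +>\<^bsub>M\<^esub> (a \<odot>\<^bsub>M\<^esub> y)) = H +>\<^bsub>M\<^esub> (a \<odot>\<^bsub>M\<^esub> x)"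
    by blast
  then show ?thesis by (simp add: quot_module_def)
qed

lemma quot_module_carrierE:
  assumes "X \<in> carrier (quot_module M H)"
  obtains x where "x \<in> carrier M" "X = H +>\<^bsub>M\<^esub> x"
  using assms by (auto simp: quot_module_simps A_RCOSETS_def')

lemma quot_module_coset_closed:
  "x \<in> carrier M \<Longrightarrow> H +>\<^bsub>M\<^esub> x \<in> carrier (quot_module M H)"
  by (auto simp: quot_module_simps A_RCOSETS_def')

lemma quot_module_module:
  assumes H: "submodule H R M"
  shows "module R (quot_module M H)"
proof (rule moduleI)
  interpret H: abelian_subgroup H M by (rule submodule_abelian_subgroup[OF H])
  let ?Q = "quot_module M H"
  show "cring R" by (rule R.is_cring)
  note sm = quot_module_smult_coset[OF H]
  have ad: "(H +>\<^bsub>M\<^esub> x) \<oplus>\<^bsub>?Q\<^esub> (H +>\<^bsub>M\<^esub> y) = H +>\<^bsub>M\<^esub> (x \<oplus>\<^bsub>M\<^esub> y)"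
    if "x \<in> carrier M" "y \<in> carrier M" for x y
    using H.a_rcos_sum that by (simp add: quot_module_simps)
  show "abelian_group ?Q"
  proof (rule abelian_groupI)
    have z: "\<zero>\<^bsub>?Q\<^esub> = H +>\<^bsub>M\<^esub> \<zero>\<^bsub>M\<^esub>"
      using H.a_rcos_const[OF H.zero_closed] by (simp add: quot_module_simps)
    show "\<zero>\<^bsub>?Q\<^esub> \<in> carrier ?Q" by (simp add: z quot_module_coset_closed)
    fix X assume "X \<in> carrier ?Q"
    then obtain x where x: "x \<in> carrier M" "X = H +>\<^bsub>M\<^esub> x" by (rule quot_module_carrierE)
    show "\<zero>\<^bsub>?Q\<^esub> \<oplus>\<^bsub>?Q\<^esub> X = X" using x by (simp add: z ad)
    show "\<exists>Y\<in>carrier ?Q. Y \<oplus>\<^bsub>?Q\<^esub> X = \<zero>\<^bsub>?Q\<^esub>"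
      using x by (intro bexI[of _ "H +>\<^bsub>M\<^esub> (\<ominus>\<^bsub>M\<^esub> x)"]) (simp_all add: z ad M.l_neg quot_module_coset_closed)
    fix Y assume "Y \<in> carrier ?Q"
    then obtain y where y: "y \<in> carrier M" "Y = H +>\<^bsub>M\<^esub> y" by (rule quot_module_carrierE)
    show "X \<oplus>\<^bsub>?Q\<^esub> Y \<in> carrier ?Q" using x y by (simp add: ad quot_module_coset_closed)
    show "X \<oplus>\<^bsub>?Q\<^esub> Y = Y \<oplus>\<^bsub>?Q\<^esub> X" using x y by (simp add: ad M.a_comm)
    fix Z assume "Z \<in> carrier ?Q"
    then obtain z where z: "z \<in> carrier M" "Z = H +>\<^bsub>M\<^esub> z" by (rule quot_module_carrierE)
    show "X \<oplus>\<^bsub>?Q\<^esub> Y \<oplus>\<^bsub>?Q\<^esub> Z = X \<oplus>\<^bsub>?Q\<^esub> (Y \<oplus>\<^bsub>?Q\<^esub> Z)" using x y z by (simp add: ad M.a_assoc)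
  qed
  show "\<one> \<odot>\<^bsub>?Q\<^esub> X = X" if "X \<in> carrier ?Q" for X
    using that by (rule quot_module_carrierE) (simp add: sm)
  fix a b X Y assume a: "a \<in> carrier R" and b: "b \<in> carrier R"
    and "X \<in> carrier ?Q" and "Y \<in> carrier ?Q"
  then obtain x y where x: "x \<in> carrier M" "X = H +>\<^bsub>M\<^esub> x" and y: "y \<in> carrier M" "Y = H +>\<^bsub>M\<^esub> y"
    by (meson quot_module_carrierE)
  show "a \<odot>\<^bsub>?Q\<^esub> X \<in> carrier ?Q" using a x by (simp add: sm quot_module_coset_closed)
  show "(a \<oplus> b) \<odot>\<^bsub>?Q\<^esub> X = a \<odot>\<^bsub>?Q\<^esub> X \<oplus>\<^bsub>?Q\<^esub> b \<odot>\<^bsub>?Q\<^esub> X" using a b x by (simp add: sm ad smult_l_distr)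
  show "a \<odot>\<^bsub>?Q\<^esub> (X \<oplus>\<^bsub>?Q\<^esub> Y) = a \<odot>\<^bsub>?Q\<^esub> X \<oplus>\<^bsub>?Q\<^esub> a \<odot>\<^bsub>?Q\<^esub> Y" using a x y by (simp add: sm ad smult_r_distr)
  show "(a \<otimes> b) \<odot>\<^bsub>?Q\<^esub> X = a \<odot>\<^bsub>?Q\<^esub> (b \<odot>\<^bsub>?Q\<^esub> X)" using a b x by (simp add: sm smult_assoc1)
qed

lemma quot_module_proj_linear:
  assumes H: "submodule H R M"
  shows "linear_map R M (quot_module M H) (\<lambda>x. H +>\<^bsub>M\<^esub> x)"
proof -
  interpret H: abelian_subgroup H M by (rule submodule_abelian_subgroup[OF H])
  show ?thesis
    by (intro linear_mapI)
       (simp_all add: quot_module_coset_closed quot_module_smult_coset[OF H],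
        simp add: quot_module_simps H.a_rcos_sum)
qed

end

section \<open>Free modules\<close>

lemma free_module_simps:
  "carrier (free_module R X) = {f \<in> X \<rightarrow>\<^sub>E carrier R. finite {x \<in> X. f x \<noteq> \<zero>\<^bsub>R\<^esub>}}"
  "zero (free_module R X) = (\<lambda>x\<in>X. \<zero>\<^bsub>R\<^esub>)"
  "add (free_module R X) = (\<lambda>f g. \<lambda>x\<in>X. f x \<oplus>\<^bsub>R\<^esub> g x)"
  "smult (free_module R X) = (\<lambda>a f. \<lambda>x\<in>X. a \<otimes>\<^bsub>R\<^esub> f x)"
  by (simp_all add: free_module_def)

definition unit_vector :: "('a, 'b) ring_scheme \<Rightarrow> 'x set \<Rightarrow> 'x \<Rightarrow> 'x \<Rightarrow> 'a" where
  "unit_vector R X x = (\<lambda>y\<in>X. if y = x then \<one>\<^bsub>R\<^esub> else \<zero>\<^bsub>R\<^esub>)"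

text \<open>The linear map from the free module on \<open>X\<close> to \<open>A\<close> that extends \<open>g\<close>. The formula has the shape of
  \<^const>\<open>free_cover\<close>, which is the case \<open>g = id\<close>.\<close>

definition linear_extension ::
  "('a, 'b) ring_scheme \<Rightarrow> 'x set \<Rightarrow> ('a, 'm, 'c) module_scheme \<Rightarrow> ('x \<Rightarrow> 'm) \<Rightarrow> ('x \<Rightarrow> 'a) \<Rightarrow> 'm" where
  "linear_extension R X A g f = (\<Oplus>\<^bsub>A\<^esub>x\<in>{x \<in> X. f x \<noteq> \<zero>\<^bsub>R\<^esub>}. f x \<odot>\<^bsub>A\<^esub> g x)"

lemma free_cover_eq: "free_cover R N = linear_extension R (carrier N) N (\<lambda>x. x)"
  by (simp add: fun_eq_iff free_cover_def linear_extension_def)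

context cring
begin

lemma free_module_add_closed:
  assumes "f \<in> carrier (free_module R X)" and "g \<in> carrier (free_module R X)"
  shows "f \<oplus>\<^bsub>free_module R X\<^esub> g \<in> carrier (free_module R X)"
proof -
  have "{x \<in> X. f x \<oplus> g x \<noteq> \<zero>} \<subseteq> {x \<in> X. f x \<noteq> \<zero>} \<union> {x \<in> X. g x \<noteq> \<zero>}" by auto
  then have "finite {x \<in> X. f x \<oplus> g x \<noteq> \<zero>}"
    by (rule finite_subset) (use assms in \<open>auto simp: free_module_simps\<close>)
  moreover have "{x \<in> X. (\<lambda>x\<in>X. f x \<oplus> g x) x \<noteq> \<zero>} = {x \<in> X. f x \<oplus> g x \<noteq> \<zero>}" by auto
  ultimately show ?thesis using assms by (auto simp: free_module_simps)
qed

lemma free_module_smult_closed: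
  assumes "a \<in> carrier R" and "f \<in> carrier (free_module R X)"
  shows "a \<odot>\<^bsub>free_module R X\<^esub> f \<in> carrier (free_module R X)"
proof -
  have "{x \<in> X. a \<otimes> f x \<noteq> \<zero>} \<subseteq> {x \<in> X. f x \<noteq> \<zero>}" using assms by auto
  then have "finite {x \<in> X. a \<otimes> f x \<noteq> \<zero>}"
    by (rule finite_subset) (use assms in \<open>auto simp: free_module_simps\<close>)
  moreover have "{x \<in> X. (\<lambda>x\<in>X. a \<otimes> f x) x \<noteq> \<zero>} = {x \<in> X. a \<otimes> f x \<noteq> \<zero>}" by auto
  ultimately show ?thesis using assms by (auto simp: free_module_simps)
qed

lemma free_module_module: "module R (free_module R X)"
proof (rule moduleI)
  let ?F = "free_module R X"
  show "cring R" by (rule is_cring)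
  have ext: "f = g" if "f \<in> carrier ?F" "g \<in> carrier ?F" "\<And>x. x \<in> X \<Longrightarrow> f x = g x" for f g
    using that by (auto simp: free_module_simps intro: PiE_ext)
  have val: "f x \<in> carrier R" if "f \<in> carrier ?F" "x \<in> X" for f x
    using that by (auto simp: free_module_simps)
  have z: "\<zero>\<^bsub>?F\<^esub> \<in> carrier ?F"
    by (auto simp: free_module_simps intro: finite_subset[of _ "{}"])
  show "abelian_group ?F"
  proof (rule abelian_groupI)
    fix f assume f: "f \<in> carrier ?F"
    show "\<exists>g\<in>carrier ?F. g \<oplus>\<^bsub>?F\<^esub> f = \<zero>\<^bsub>?F\<^esub>"
    proof (rule bexI)
      show c: "(\<ominus> \<one>) \<odot>\<^bsub>?F\<^esub> f \<in> carrier ?F" using f by (simp add: free_module_smult_closed)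
      show "((\<ominus> \<one>) \<odot>\<^bsub>?F\<^esub> f) \<oplus>\<^bsub>?F\<^esub> f = \<zero>\<^bsub>?F\<^esub>"
        by (rule ext[OF free_module_add_closed[OF c f] z])
           (use val[OF f] in \<open>simp add: free_module_simps l_minus l_neg\<close>)
    qed
  next
    fix f g h assume fgh: "f \<in> carrier ?F" "g \<in> carrier ?F" "h \<in> carrier ?F"
    show "f \<oplus>\<^bsub>?F\<^esub> g \<oplus>\<^bsub>?F\<^esub> h = f \<oplus>\<^bsub>?F\<^esub> (g \<oplus>\<^bsub>?F\<^esub> h)"
      by (rule ext) (use fgh val in \<open>simp_all add: free_module_add_closed\<close>, simp add: free_module_simps a_assoc)
  next
    fix f g assume fg: "f \<in> carrier ?F" "g \<in> carrier ?F"
    show "f \<oplus>\<^bsub>?F\<^esub> g = g \<oplus>\<^bsub>?F\<^esub> f"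
      by (rule ext) (use fg val in \<open>simp_all add: free_module_add_closed\<close>, simp add: free_module_simps a_comm)
  next
    fix f assume f: "f \<in> carrier ?F"
    show "\<zero>\<^bsub>?F\<^esub> \<oplus>\<^bsub>?F\<^esub> f = f"
      by (rule ext) (use f z val in \<open>simp_all add: free_module_add_closed\<close>, simp add: free_module_simps)
  qed (use z free_module_add_closed in auto)
  show "\<one> \<odot>\<^bsub>?F\<^esub> f = f" if "f \<in> carrier ?F" for f
    by (rule ext) (use that val in \<open>simp_all add: free_module_smult_closed\<close>, simp add: free_module_simps)
  fix a b f g assume a: "a \<in> carrier R" and b: "b \<in> carrier R"
    and f: "f \<in> carrier ?F" and g: "g \<in> carrier ?F"
  note cl = free_module_smult_closed free_module_add_closed
  show "a \<odot>\<^bsub>?F\<^esub> f \<in> carrier ?F" by (simp add: a f cl)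
  show "(a \<oplus> b) \<odot>\<^bsub>?F\<^esub> f = a \<odot>\<^bsub>?F\<^esub> f \<oplus>\<^bsub>?F\<^esub> b \<odot>\<^bsub>?F\<^esub> f"
    by (rule ext) (use a b f val in \<open>simp_all add: cl\<close>, simp add: free_module_simps l_distr)
  show "a \<odot>\<^bsub>?F\<^esub> (f \<oplus>\<^bsub>?F\<^esub> g) = a \<odot>\<^bsub>?F\<^esub> f \<oplus>\<^bsub>?F\<^esub> a \<odot>\<^bsub>?F\<^esub> g"
    by (rule ext) (use a f g val in \<open>simp_all add: cl\<close>, simp add: free_module_simps r_distr)
  show "(a \<otimes> b) \<odot>\<^bsub>?F\<^esub> f = a \<odot>\<^bsub>?F\<^esub> (b \<odot>\<^bsub>?F\<^esub> f)"
    by (rule ext) (use a b f val in \<open>simp_all add: cl\<close>, simp add: free_module_simps m_assoc)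
qed

lemma unit_vector_closed: "unit_vector R X x \<in> carrier (free_module R X)"
  by (auto simp: unit_vector_def free_module_simps intro: finite_subset[of _ "{x}"])

text \<open>Every vector has finite support, so it is reached from \<open>0\<close> by finitely many steps that each add a
  multiple of a unit vector.\<close>

lemma free_module_generated:
  assumes U: "submodule U R (free_module R X)"
    and units: "\<And>x. x \<in> X \<Longrightarrow> unit_vector R X x \<in> U"
  shows "U = carrier (free_module R X)"
proof
  let ?F = "free_module R X"
  interpret F: module R ?F by (rule free_module_module)
  show "U \<subseteq> carrier ?F" by (rule F.submoduleE(1)[OF U])
  have val: "f x \<in> carrier R" if "f \<in> carrier ?F" "x \<in> X" for f x
    using that by (auto simp: free_module_simps)
  have "f \<in> U" if "finite T" "f \<in> carrier ?F" "{x \<in> X. f x \<noteq> \<zero>} \<subseteq> T" for f T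
    using that
  proof (induction T arbitrary: f rule: finite_induct)
    case empty
    then have "f = \<zero>\<^bsub>?F\<^esub>" by (auto simp: free_module_simps PiE_def extensional_def fun_eq_iff)
    then show ?case using F.submodule_zero[OF U] by simp
  next
    case (insert t T)
    show ?case
    proof (cases "t \<in> X")
      case False
      then show ?thesis using insert by blast
    next
      case True
      define g where "g = f(t := \<zero>)"
      have g: "g \<in> carrier ?F"
      proof -
        have "{x \<in> X. g x \<noteq> \<zero>} \<subseteq> {x \<in> X. f x \<noteq> \<zero>}" by (auto simp: g_def)
        then have "finite {x \<in> X. g x \<noteq> \<zero>}"
          by (rule finite_subset) (use insert.prems(1) in \<open>simp add: free_module_simps\<close>)
        then show ?thesis
          using insert.prems(1) True by (auto simp: free_module_simps g_def PiE_def extensional_def)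
      qed
      have "x \<in> T" if "x \<in> X" "g x \<noteq> \<zero>" for x
        using insert.prems(2) that by (cases "x = t") (simp_all add: g_def subset_iff, blast)
      then have gU: "g \<in> U" by (intro insert.IH[OF g]) auto
      have "f t \<odot>\<^bsub>?F\<^esub> unit_vector R X t \<in> U"
        using F.submoduleE(4)[OF U] units[OF True] val[OF insert.prems(1) True] by blast
      then have "g \<oplus>\<^bsub>?F\<^esub> (f t \<odot>\<^bsub>?F\<^esub> unit_vector R X t) \<in> U"
        using F.submoduleE(5)[OF U] gU by blast
      moreover have "g \<oplus>\<^bsub>?F\<^esub> (f t \<odot>\<^bsub>?F\<^esub> unit_vector R X t) = f"
      proof
        fix x show "(g \<oplus>\<^bsub>?F\<^esub> (f t \<odot>\<^bsub>?F\<^esub> unit_vector R X t)) x = f x"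
          using insert.prems(1) val[OF insert.prems(1)] True
          by (cases "x \<in> X") (auto simp: free_module_simps g_def unit_vector_def PiE_def extensional_def)
      qed
      ultimately show ?thesis by simp
    qed
  qed
  then show "carrier ?F \<subseteq> U" by (auto simp: free_module_simps(1))
qed

lemma linear_map_free_module_eqI:
  assumes B: "module R B" and f: "linear_map R (free_module R X) B f" and g: "linear_map R (free_module R X) B g"
    and eq: "\<And>x. x \<in> X \<Longrightarrow> f (unit_vector R X x) = g (unit_vector R X x)"
    and c: "c \<in> carrier (free_module R X)"
  shows "f c = g c"
proof -
  have "{c \<in> carrier (free_module R X). f c = g c} = carrier (free_module R X)"
    by (rule free_module_generated[OF submodule_equalizer[OF free_module_module B f g]])
       (simp add: unit_vector_closed eq)
  then show ?thesis using c by blast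
qed

end

context module
begin

text \<open>The support varies with \<open>f\<close>; to compare the extensions of several vectors, all sums are taken over a
  common finite set.\<close>

lemma linear_extension_superset:
  assumes g: "g \<in> X \<rightarrow> carrier M" and f: "f \<in> carrier (free_module R X)"
    and T: "finite T" "{x \<in> X. f x \<noteq> \<zero>} \<subseteq> T" "T \<subseteq> X"
  shows "linear_extension R X M g f = (\<Oplus>\<^bsub>M\<^esub>x\<in>T. f x \<odot>\<^bsub>M\<^esub> g x)"
  unfolding linear_extension_def
  by (rule M.add.finprod_mono_neutral_cong_left)
     (use T g f in \<open>auto simp: free_module_simps PiE_def Pi_def subset_iff\<close>)

lemma linear_extension_linear:
  assumes g: "g \<in> X \<rightarrow> carrier M"
  shows "linear_map R (free_module R X) M (linear_extension R X M g)"
proof (rule linear_mapI)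
  let ?F = "free_module R X" and ?L = "linear_extension R X M g"
  let ?supp = "\<lambda>f. {x \<in> X. f x \<noteq> \<zero>}"
  have fin: "finite (?supp f)" if "f \<in> carrier ?F" for f using that by (simp add: free_module_simps)
  have val: "f x \<in> carrier R" if "f \<in> carrier ?F" "x \<in> X" for f x
    using that by (auto simp: free_module_simps)
  have gv: "g x \<in> carrier M" if "x \<in> X" for x using g that by auto
  fix f assume f: "f \<in> carrier ?F"
  show "?L f \<in> carrier M"
    unfolding linear_extension_def by (rule M.finsum_closed) (use val[OF f] gv in auto)
  {
    fix h assume h: "h \<in> carrier ?F"
    let ?T = "?supp f \<union> ?supp h"
    have T: "finite ?T" "?T \<subseteq> X" using fin f h by auto
    have sub: "?supp (f \<oplus>\<^bsub>?F\<^esub> h) \<subseteq> ?T" by (auto simp: free_module_simps)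
    have "?L (f \<oplus>\<^bsub>?F\<^esub> h) = (\<Oplus>\<^bsub>M\<^esub>x\<in>?T. (f \<oplus>\<^bsub>?F\<^esub> h) x \<odot>\<^bsub>M\<^esub> g x)"
      by (rule linear_extension_superset[OF g R.free_module_add_closed[OF f h] T(1) sub T(2)])
    also have "\<dots> = (\<Oplus>\<^bsub>M\<^esub>x\<in>?T. f x \<odot>\<^bsub>M\<^esub> g x \<oplus>\<^bsub>M\<^esub> h x \<odot>\<^bsub>M\<^esub> g x)"
      by (rule M.finsum_cong')
         (use T val[OF f] val[OF h] gv in \<open>auto simp: free_module_simps smult_l_distr\<close>)
    also have "\<dots> = (\<Oplus>\<^bsub>M\<^esub>x\<in>?T. f x \<odot>\<^bsub>M\<^esub> g x) \<oplus>\<^bsub>M\<^esub> (\<Oplus>\<^bsub>M\<^esub>x\<in>?T. h x \<odot>\<^bsub>M\<^esub> g x)"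
      by (rule M.finsum_addf) (use T val[OF f] val[OF h] gv in auto)
    also have "\<dots> = ?L f \<oplus>\<^bsub>M\<^esub> ?L h"
      using linear_extension_superset[OF g f T(1) _ T(2)] linear_extension_superset[OF g h T(1) _ T(2)]
      by simp
    finally show "?L (f \<oplus>\<^bsub>?F\<^esub> h) = ?L f \<oplus>\<^bsub>M\<^esub> ?L h" .
  }
  fix a assume a: "a \<in> carrier R"
  have sub: "?supp (a \<odot>\<^bsub>?F\<^esub> f) \<subseteq> ?supp f" using a by (auto simp: free_module_simps)
  have "?L (a \<odot>\<^bsub>?F\<^esub> f) = (\<Oplus>\<^bsub>M\<^esub>x\<in>?supp f. (a \<odot>\<^bsub>?F\<^esub> f) x \<odot>\<^bsub>M\<^esub> g x)"
    by (rule linear_extension_superset[OF g R.free_module_smult_closed[OF a f] fin[OF f] sub]) auto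
  also have "\<dots> = (\<Oplus>\<^bsub>M\<^esub>x\<in>?supp f. a \<odot>\<^bsub>M\<^esub> (f x \<odot>\<^bsub>M\<^esub> g x))"
    by (rule M.finsum_cong') (use a val[OF f] gv in \<open>auto simp: free_module_simps smult_assoc1\<close>)
  also have "\<dots> = a \<odot>\<^bsub>M\<^esub> ?L f"
    unfolding linear_extension_def
    by (rule finsum_smult_ldistr[symmetric]) (use a fin[OF f] val[OF f] gv in auto)
  finally show "?L (a \<odot>\<^bsub>?F\<^esub> f) = a \<odot>\<^bsub>M\<^esub> ?L f" .
qed

lemma linear_extension_unit_vector:
  assumes g: "g \<in> X \<rightarrow> carrier M" and x: "x \<in> X"
  shows "linear_extension R X M g (unit_vector R X x) = g x"
proof -
  have "linear_extension R X M g (unit_vector R X x) = (\<Oplus>\<^bsub>M\<^esub>y\<in>{x}. unit_vector R X x y \<odot>\<^bsub>M\<^esub> g y)"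
    by (rule linear_extension_superset[OF g R.unit_vector_closed])
       (use x in \<open>auto simp: unit_vector_def\<close>)
  also have "\<dots> = g x"
    using g x M.add.finprod_singleton by (simp add: unit_vector_def Pi_def)
  finally show ?thesis .
qed

end

section \<open>\<open>Ext\<^sup>1\<close> of a cyclic module\<close>

lemma (in abelian_group) minus_add_cancel:
  "x \<in> carrier G \<Longrightarrow> y \<in> carrier G \<Longrightarrow> (x \<ominus> y) \<oplus> y = x"
  by (simp add: a_minus_def a_assoc l_neg)

lemma (in abelian_group) minus_eq_zero_iff:
  assumes "x \<in> carrier G" and "y \<in> carrier G"
  shows "x \<ominus> y = \<zero> \<longleftrightarrow> x = y"
  using minus_add_cancel[OF assms] assms by (auto simp: a_minus_def r_neg)

lemma linear_map_add:
  assumes A: "module R A" and B: "module R B" and f: "linear_map R A B f" and g: "linear_map R A B g"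
  shows "linear_map R A B (\<lambda>x. f x \<oplus>\<^bsub>B\<^esub> g x)"
proof -
  interpret A: module R A by fact
  interpret B: module R B by fact
  show ?thesis
    by (intro linear_mapI) (simp_all add: linear_mapD[OF f] linear_mapD[OF g] B.M.a_ac B.smult_r_distr)
qed

lemma linear_map_diff:
  assumes A: "module R A" and B: "module R B" and f: "linear_map R A B f" and g: "linear_map R A B g"
  shows "linear_map R A B (\<lambda>x. f x \<ominus>\<^bsub>B\<^esub> g x)"
proof -
  interpret B: module R B by fact
  have m: "\<ominus>\<^bsub>R\<^esub> \<one>\<^bsub>R\<^esub> \<in> carrier R" by simp
  have "linear_map R A B (\<lambda>x. f x \<oplus>\<^bsub>B\<^esub> (\<ominus>\<^bsub>R\<^esub> \<one>\<^bsub>R\<^esub>) \<odot>\<^bsub>B\<^esub> g x)"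
    by (rule linear_map_add[OF A B f linear_map_comp[OF g B.smult_linear[OF m]]])
  then show ?thesis
    by (rule linear_map_cong[OF A])
       (simp add: a_minus_def B.smult_l_minus linear_mapD[OF g])
qed

lemma linear_map_const_zero:
  assumes "module R B"
  shows "linear_map R A B (\<lambda>x. \<zero>\<^bsub>B\<^esub>)"
proof -
  interpret B: module R B by fact
  show ?thesis by (intro linear_mapI) simp_all
qed

lemma syzygy_simps:
  "carrier (syzygy R N) =
     {f \<in> carrier (free_module R (carrier N)). free_cover R N f = \<zero>\<^bsub>N\<^esub>}"
  "zero (syzygy R N) = zero (free_module R (carrier N))"
  "add (syzygy R N) = add (free_module R (carrier N))"
  "smult (syzygy R N) = smult (free_module R (carrier N))"
  by (simp_all add: syzygy_def a_kernel_def kernel_def)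

context module
begin

lemma free_cover_linear: "linear_map R (free_module R (carrier M)) M (free_cover R M)"
  unfolding free_cover_eq by (rule linear_extension_linear) auto

lemma free_cover_unit_vector:
  "x \<in> carrier M \<Longrightarrow> free_cover R M (unit_vector R (carrier M) x) = x"
  unfolding free_cover_eq by (rule linear_extension_unit_vector) auto

lemma zero_submodule: "submodule {\<zero>\<^bsub>M\<^esub>} R M"
  by (rule submoduleI') auto

lemma syzygy_submodule: "submodule (carrier (syzygy R M)) R (free_module R (carrier M))"
  using submodule_vimage[OF R.free_module_module module_axioms free_cover_linear zero_submodule]
  by (simp add: syzygy_simps)

lemma syzygy_module: "module R (syzygy R M)"
  using submodule.submodule_is_module[OF syzygy_submodule R.free_module_module]
  by (simp add: syzygy_def)

end

text \<open>Since this holds for arbitrary \<open>B\<close> and \<open>C\<close>, it applies to the cocycles and coboundaries without first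
  proving that they form modules.\<close>

lemma quot_module_trivial_iff:
  "carrier (quot_module C B) = {\<zero>\<^bsub>quot_module C B\<^esub>} \<longleftrightarrow>
     carrier C \<noteq> {} \<and> (\<forall>\<phi>\<in>carrier C. (\<lambda>b. b \<oplus>\<^bsub>C\<^esub> \<phi>) ` B = B)"
proof -
  have "carrier (quot_module C B) = (\<lambda>\<phi>. (\<lambda>b. b \<oplus>\<^bsub>C\<^esub> \<phi>) ` B) ` carrier C"
    by (auto simp: quot_module_def A_RCOSETS_def' a_r_coset_def')
  moreover have "h ` C' = {c} \<longleftrightarrow> C' \<noteq> {} \<and> (\<forall>\<phi>\<in>C'. h \<phi> = c)"
    for h :: "'e \<Rightarrow> 'f" and C' c by auto
  ultimately show ?thesis by (simp add: quot_module_def)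
qed

text \<open>In the resolution \<open>F\<^sub>2 \<rightarrow> F\<^sub>1 \<rightarrow> F\<^sub>0 \<rightarrow> N\<close> with syzygies \<open>K\<^sub>1 = ker (F\<^sub>0 \<rightarrow> N)\<close> and \<open>K\<^sub>2 = ker (F\<^sub>1 \<rightarrow> K\<^sub>1)\<close>, a
  cocycle on \<open>F\<^sub>1\<close> kills \<open>K\<^sub>2\<close>, so it is the same as a linear map on \<open>K\<^sub>1\<close>. It is a coboundary iff that
  map extends to \<open>F\<^sub>0\<close>.\<close>

lemma Ext1_trivial_iff:
  assumes N: "module R N" and A: "module R A"
  shows "carrier (Ext1 R N A) = {\<zero>\<^bsub>Ext1 R N A\<^esub>} \<longleftrightarrow>
    (\<forall>g. linear_map R (syzygy R N) A g \<longrightarrow>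
      (\<exists>\<psi>. linear_map R (free_module R (carrier N)) A \<psi> \<and> (\<forall>k\<in>carrier (syzygy R N). \<psi> k = g k)))"
    (is "_ \<longleftrightarrow> ?ext")
proof -
  interpret N: module R N by fact
  interpret A: module R A by fact
  define K1 where "K1 = syzygy R N"
  define F0 where "F0 = free_module R (carrier N)"
  have K1: "module R K1" unfolding K1_def by (rule N.syzygy_module)
  interpret K1: module R K1 by (rule K1)
  define K2 where "K2 = syzygy R K1"
  define F1 where "F1 = free_module R (carrier K1)"
  define F2 where "F2 = free_module R (carrier K2)"
  have K2: "module R K2" unfolding K2_def by (rule K1.syzygy_module)
  interpret K2: module R K2 by (rule K2)
  have F0: "module R F0" unfolding F0_def by (rule N.R.free_module_module)
  have F1: "module R F1" unfolding F1_def by (rule N.R.free_module_module)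
  interpret F0: module R F0 by (rule F0)
  interpret F1: module R F1 by (rule F1)
  define d1 where "d1 = free_cover R K1"
  define d2 where "d2 = free_cover R K2"
  define Z where "Z = {\<phi> \<in> carrier (Hom_module R F1 A). \<forall>z\<in>carrier F2. \<phi> (d2 z) = \<zero>\<^bsub>A\<^esub>}"
  define B where "B = (\<lambda>\<psi>. compose (carrier F1) \<psi> d1) ` carrier (Hom_module R F0 A)"
  let ?C = "(Hom_module R F1 A)\<lparr>carrier := Z\<rparr>"
  have Ext: "Ext1 R N A = quot_module ?C B"
    by (simp add: Ext1_def Let_def K1_def K2_def F0_def F1_def F2_def d1_def d2_def Z_def B_def)
  have d1: "linear_map R F1 K1 d1" unfolding d1_def F1_def by (rule K1.free_cover_linear)
  have d1F0: "linear_map R F1 F0 d1"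
    using d1 by (auto simp: linear_map_def K1_def F0_def syzygy_simps)
  have K2_iff: "f \<in> carrier K2 \<longleftrightarrow> f \<in> carrier F1 \<and> d1 f = \<zero>\<^bsub>K1\<^esub>" for f
    by (simp add: K2_def syzygy_simps F1_def d1_def)
  define e where "e k = unit_vector R (carrier K1) k" for k
  have e: "e k \<in> carrier F1" for k
    unfolding e_def F1_def by (rule N.R.unit_vector_closed)
  have d1e: "d1 (e k) = k" if "k \<in> carrier K1" for k
    unfolding e_def d1_def by (rule K1.free_cover_unit_vector[OF that])
  \<comment> \<open>A cocycle kills the image of \<open>d2\<close>, which is the kernel of \<open>d1\<close>.\<close>
  have cocycle: "\<phi> f = \<phi> f'" if \<phi>: "\<phi> \<in> Z" and f: "f \<in> carrier F1" "f' \<in> carrier F1" "d1 f = d1 f'" for \<phi> f f'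
  proof -
    have lin: "linear_map R F1 A \<phi>" using \<phi> by (simp add: Z_def Hom_module_iff)
    have "d1 (f \<ominus>\<^bsub>F1\<^esub> f') = \<zero>\<^bsub>K1\<^esub>"
      unfolding linear_map_minus[OF F1 K1 d1 f(1,2)] f(3)
      using linear_mapD(1)[OF d1 f(2)] by (simp add: K1.M.r_neg a_minus_def)
    then have k: "f \<ominus>\<^bsub>F1\<^esub> f' \<in> carrier K2" using f by (simp add: K2_iff)
    have "\<phi> (d2 (unit_vector R (carrier K2) (f \<ominus>\<^bsub>F1\<^esub> f'))) = \<zero>\<^bsub>A\<^esub>"
      using \<phi> by (simp add: Z_def F2_def N.R.unit_vector_closed)
    then have "\<phi> (f \<ominus>\<^bsub>F1\<^esub> f') = \<zero>\<^bsub>A\<^esub>"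
      using k by (simp add: d2_def K2.free_cover_unit_vector)
    then have "\<phi> f \<ominus>\<^bsub>A\<^esub> \<phi> f' = \<zero>\<^bsub>A\<^esub>" using f by (simp add: linear_map_minus[OF F1 A lin])
    then show ?thesis using f A.M.minus_eq_zero_iff linear_mapD(1)[OF lin] by blast
  qed
  have pullback_cocycle: "restrict (\<lambda>f. g (d1 f)) (carrier F1) \<in> Z" if g: "linear_map R K1 A g" for g
  proof -
    have "d2 z \<in> carrier K2" if "z \<in> carrier F2" for z
      using that linear_mapD(1)[OF K2.free_cover_linear] by (simp add: d2_def F2_def)
    then have "d2 z \<in> carrier F1 \<and> g (d1 (d2 z)) = \<zero>\<^bsub>A\<^esub>" if "z \<in> carrier F2" for z
      using that linear_map_zero[OF K1 A g] unfolding K2_iff by auto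
    then show ?thesis
      unfolding Z_def using restrict_in_Hom_module[OF F1 linear_map_comp[OF d1 g]] by simp
  qed
  have zeroZ: "(\<lambda>x\<in>carrier F1. \<zero>\<^bsub>A\<^esub>) \<in> Z"
    using pullback_cocycle[OF linear_map_const_zero[OF A]] .
  have BI: "restrict (\<lambda>f. \<psi> (d1 f)) (carrier F1) \<in> B" if "linear_map R F0 A \<psi>" for \<psi>
  proof -
    have "compose (carrier F1) (restrict \<psi> (carrier F0)) d1 = restrict (\<lambda>f. \<psi> (d1 f)) (carrier F1)"
      using linear_mapD(1)[OF d1F0] by (auto simp: compose_def fun_eq_iff)
    then show ?thesis
      unfolding B_def using restrict_in_Hom_module[OF F0 that] by (metis image_eqI)
  qed
  have BE: "\<exists>\<psi>. linear_map R F0 A \<psi> \<and> b = restrict (\<lambda>f. \<psi> (d1 f)) (carrier F1)" if "b \<in> B" for b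
    using that by (auto simp: B_def Hom_module_iff compose_def)
  define plus where "plus b \<phi> = (\<lambda>x\<in>carrier F1. b x \<oplus>\<^bsub>A\<^esub> \<phi> x)" for b \<phi>
  have add: "b \<oplus>\<^bsub>?C\<^esub> \<phi> = plus b \<phi>" for b \<phi>
    by (simp add: Hom_module_def plus_def)
  have "carrier (Ext1 R N A) = {\<zero>\<^bsub>Ext1 R N A\<^esub>} \<longleftrightarrow> Z \<subseteq> B"
  proof -
    have "(\<forall>\<phi>\<in>Z. (\<lambda>b. plus b \<phi>) ` B = B) \<longleftrightarrow> Z \<subseteq> B"
    proof
      assume *: "\<forall>\<phi>\<in>Z. (\<lambda>b. plus b \<phi>) ` B = B"
      show "Z \<subseteq> B"
      proof
        fix \<phi> assume \<phi>: "\<phi> \<in> Z"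
        then have lin: "linear_map R F1 A \<phi>" and ext: "\<phi> \<in> extensional (carrier F1)"
          by (simp_all add: Z_def Hom_module_iff)
        have "(\<lambda>x\<in>carrier F1. \<zero>\<^bsub>A\<^esub>) \<in> B" using BI[OF linear_map_const_zero[OF A]] .
        then have "plus (\<lambda>x\<in>carrier F1. \<zero>\<^bsub>A\<^esub>) \<phi> \<in> B" using *[rule_format, OF \<phi>] by blast
        moreover have "plus (\<lambda>x\<in>carrier F1. \<zero>\<^bsub>A\<^esub>) \<phi> = \<phi>"
          unfolding plus_def using ext linear_mapD(1)[OF lin] by (auto simp: fun_eq_iff extensional_def)
        ultimately show "\<phi> \<in> B" by simp
      qed
    next
      assume ZB: "Z \<subseteq> B"
      show "\<forall>\<phi>\<in>Z. (\<lambda>b. plus b \<phi>) ` B = B"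
      proof (intro ballI equalityI subsetI)
        fix \<phi> c assume "\<phi> \<in> Z" and "c \<in> (\<lambda>b. plus b \<phi>) ` B"
        then obtain b where b: "b \<in> B" "c = plus b \<phi>" by blast
        obtain \<psi> where \<psi>: "linear_map R F0 A \<psi>" "\<phi> = restrict (\<lambda>f. \<psi> (d1 f)) (carrier F1)"
          using BE ZB \<open>\<phi> \<in> Z\<close> by blast
        obtain \<chi> where \<chi>: "linear_map R F0 A \<chi>" "b = restrict (\<lambda>f. \<chi> (d1 f)) (carrier F1)"
          using BE b by blast
        have "c = restrict (\<lambda>f. \<chi> (d1 f) \<oplus>\<^bsub>A\<^esub> \<psi> (d1 f)) (carrier F1)"
          unfolding b(2) plus_def unfolding \<psi>(2) \<chi>(2) by (auto simp: fun_eq_iff)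
        then show "c \<in> B" using BI[OF linear_map_add[OF F0 A \<chi>(1) \<psi>(1)]] by simp
      next
        fix \<phi> b assume "\<phi> \<in> Z" and b: "b \<in> B"
        obtain \<psi> where \<psi>: "linear_map R F0 A \<psi>" "\<phi> = restrict (\<lambda>f. \<psi> (d1 f)) (carrier F1)"
          using BE ZB \<open>\<phi> \<in> Z\<close> by blast
        obtain \<chi> where \<chi>: "linear_map R F0 A \<chi>" "b = restrict (\<lambda>f. \<chi> (d1 f)) (carrier F1)"
          using BE b by blast
        let ?c = "restrict (\<lambda>f. \<chi> (d1 f) \<ominus>\<^bsub>A\<^esub> \<psi> (d1 f)) (carrier F1)"
        have "?c \<in> B" by (rule BI[OF linear_map_diff[OF F0 A \<chi>(1) \<psi>(1)]])
        moreover have "b = plus ?c \<phi>"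
        proof -
          have "\<chi> (d1 f) = (\<chi> (d1 f) \<ominus>\<^bsub>A\<^esub> \<psi> (d1 f)) \<oplus>\<^bsub>A\<^esub> \<psi> (d1 f)" if "f \<in> carrier F1" for f
            using linear_mapD(1)[OF \<chi>(1)] linear_mapD(1)[OF \<psi>(1)] linear_mapD(1)[OF d1F0] that
            by (simp add: A.M.minus_add_cancel)
          then show ?thesis
            unfolding plus_def unfolding \<psi>(2) \<chi>(2) by (auto simp: fun_eq_iff)
        qed
        ultimately show "b \<in> (\<lambda>b. plus b \<phi>) ` B" by blast
      qed
    qed
    moreover have "carrier ?C = Z" by simp
    ultimately show ?thesis unfolding Ext quot_module_trivial_iff add using zeroZ by auto
  qed
  also have "\<dots> \<longleftrightarrow> ?ext"
  proof
    assume ZB: "Z \<subseteq> B"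
    show ?ext
    proof (intro allI impI)
      fix g assume "linear_map R (syzygy R N) A g"
      then have g: "linear_map R K1 A g" by (simp add: K1_def)
      then have "restrict (\<lambda>f. g (d1 f)) (carrier F1) \<in> B" using pullback_cocycle ZB by blast
      then obtain \<psi> where \<psi>: "linear_map R F0 A \<psi>"
        and eq: "restrict (\<lambda>f. g (d1 f)) (carrier F1) = restrict (\<lambda>f. \<psi> (d1 f)) (carrier F1)"
        using BE by blast
      have "\<psi> k = g k" if "k \<in> carrier K1" for k
        using fun_cong[OF eq, of "e k"] e d1e[OF that] by simp
      with \<psi> show "\<exists>\<psi>. linear_map R (free_module R (carrier N)) A \<psi> \<and> (\<forall>k\<in>carrier (syzygy R N). \<psi> k = g k)"
        by (auto simp: F0_def K1_def)
    qed
  next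
    assume ext: ?ext
    show "Z \<subseteq> B"
    proof
      fix \<phi> assume \<phi>: "\<phi> \<in> Z"
      then have lin: "linear_map R F1 A \<phi>" and extl: "\<phi> \<in> extensional (carrier F1)"
        by (simp_all add: Z_def Hom_module_iff)
      have \<phi>e: "\<phi> (e (d1 f)) = \<phi> f" if "f \<in> carrier F1" for f
        by (rule cocycle[OF \<phi> e that]) (simp add: d1e linear_mapD(1)[OF d1] that)
      have "linear_map R K1 A (\<lambda>k. \<phi> (e k))"
      proof (rule linear_mapI)
        fix k l assume k: "k \<in> carrier K1" and l: "l \<in> carrier K1"
        have "\<phi> (e (k \<oplus>\<^bsub>K1\<^esub> l)) = \<phi> (e k \<oplus>\<^bsub>F1\<^esub> e l)"
          using \<phi>e[of "e k \<oplus>\<^bsub>F1\<^esub> e l"] e k l by (simp add: linear_mapD(2)[OF d1] d1e)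
        then show "\<phi> (e (k \<oplus>\<^bsub>K1\<^esub> l)) = \<phi> (e k) \<oplus>\<^bsub>A\<^esub> \<phi> (e l)"
          using e by (simp add: linear_mapD(2)[OF lin])
      next
        fix a k assume a: "a \<in> carrier R" and k: "k \<in> carrier K1"
        have "\<phi> (e (a \<odot>\<^bsub>K1\<^esub> k)) = \<phi> (a \<odot>\<^bsub>F1\<^esub> e k)"
          using \<phi>e[of "a \<odot>\<^bsub>F1\<^esub> e k"] e k a by (simp add: linear_mapD(3)[OF d1] d1e)
        then show "\<phi> (e (a \<odot>\<^bsub>K1\<^esub> k)) = a \<odot>\<^bsub>A\<^esub> \<phi> (e k)"
          using e a by (simp add: linear_mapD(3)[OF lin])
      qed (use e linear_mapD(1)[OF lin] in auto)
      then obtain \<psi> where \<psi>: "linear_map R F0 A \<psi>" and eq: "\<forall>k\<in>carrier K1. \<psi> k = \<phi> (e k)"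
        using ext unfolding K1_def F0_def by blast
      have "\<phi> = restrict (\<lambda>f. \<psi> (d1 f)) (carrier F1)"
        using extl eq \<phi>e linear_mapD(1)[OF d1] by (auto simp: fun_eq_iff extensional_def)
      then show "\<phi> \<in> B" using BI[OF \<psi>] by simp
    qed
  qed
  finally show ?thesis .
qed

text \<open>The cover \<open>F\<^sub>0 \<rightarrow> R/J\<close> lifts to \<open>\<pi> : F\<^sub>0 \<rightarrow> R\<close>, and some basis vector \<open>e\<close> of \<open>F\<^sub>0\<close> has \<open>\<pi> e = 1\<close>. Then
  \<open>K\<^sub>1\<close> is the preimage of \<open>J\<close> under \<open>\<pi>\<close>, and \<open>j \<mapsto> j e\<close> embeds \<open>J\<close> in \<open>K\<^sub>1\<close>. A map on \<open>J\<close> pulls back along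
  \<open>\<pi>\<close> to \<open>K\<^sub>1\<close>, and the value at \<open>e\<close> of an extension to \<open>F\<^sub>0\<close> is the desired \<open>y\<close>. Conversely a map \<open>g\<close> on
  \<open>K\<^sub>1\<close> gives \<open>y\<close> with \<open>g (j e) = j y\<close>, and \<open>f \<mapsto> g (f - \<pi> f e) + \<pi> f y\<close> extends \<open>g\<close>.\<close>

lemma Ext1_cyclic_trivial_iff:
  fixes R :: "('a, 'b) ring_scheme" (structure)
  assumes J: "ideal J R" and A: "module R A"
  defines "N \<equiv> quot_module (ring_as_module R) J"
  shows "carrier (Ext1 R N A) = {\<zero>\<^bsub>Ext1 R N A\<^esub>} \<longleftrightarrow>
    (\<forall>\<phi>. linear_map R (ideal_as_module R J) A \<phi> \<longrightarrow> (\<exists>y\<in>carrier A. \<forall>j\<in>J. \<phi> j = j \<odot>\<^bsub>A\<^esub> y))"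
    (is "_ \<longleftrightarrow> ?ext")
proof -
  interpret A: module R A by fact
  let ?R = "ring_as_module R"
  have R: "module R ?R" by (rule A.R.ring_as_module_module)
  interpret RM: module R ?R by (rule R)
  have Js: "submodule J R ?R" using J by (simp add: A.R.submodule_ring_as_module_iff)
  have JM: "module R (ideal_as_module R J)" by (rule A.R.ideal_as_module_module[OF J])
  have N: "module R N" unfolding N_def by (rule RM.quot_module_module[OF Js])
  interpret N: module R N by (rule N)
  define F0 where "F0 = free_module R (carrier N)"
  define K1 where "K1 = syzygy R N"
  have F0: "module R F0" unfolding F0_def by (rule A.R.free_module_module)
  interpret F0: module R F0 by (rule F0)
  have K1: "module R K1" unfolding K1_def by (rule N.syzygy_module)
  define q where "q r = J +>\<^bsub>?R\<^esub> r" for r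
  have q: "linear_map R ?R N q"
    unfolding q_def N_def by (rule RM.quot_module_proj_linear[OF Js])
  have q_ker: "q r = \<zero>\<^bsub>N\<^esub> \<longleftrightarrow> r \<in> J" if r: "r \<in> carrier R" for r
    using RM.quot_module_coset_iff[OF Js, of r \<zero>] linear_map_zero[OF R N q] r
    by (simp add: q_def a_minus_def)
  \<comment> \<open>Lift the cover of \<open>R/J\<close> through \<open>R\<close>, choosing \<open>1\<close> over the generator.\<close>
  define \<rho> where "\<rho> X = (if X = q \<one> then \<one> else SOME r. r \<in> carrier R \<and> q r = X)" for X
  have \<rho>: "\<rho> X \<in> carrier R \<and> q (\<rho> X) = X" if "X \<in> carrier N" for X
  proof -
    have "\<exists>r. r \<in> carrier R \<and> q r = X"
      using that unfolding N_def q_def by (metis RM.quot_module_carrierE ring_as_module_simps(1))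
    from someI_ex[OF this] show ?thesis by (simp add: \<rho>_def)
  qed
  have \<rho>': "\<rho> \<in> carrier N \<rightarrow> carrier ?R" using \<rho> by auto
  define \<pi> where "\<pi> = linear_extension R (carrier N) ?R \<rho>"
  have \<pi>: "linear_map R F0 ?R \<pi>"
    unfolding \<pi>_def F0_def by (rule RM.linear_extension_linear[OF \<rho>'])
  have cover: "free_cover R N f = q (\<pi> f)" if f: "f \<in> carrier F0" for f
    by (rule A.R.linear_map_free_module_eqI[OF N N.free_cover_linear linear_map_comp[OF \<pi>[unfolded F0_def] q] _
          f[unfolded F0_def]])
       (simp add: N.free_cover_unit_vector \<pi>_def RM.linear_extension_unit_vector[OF \<rho>'] \<rho>)
  have K1_iff: "f \<in> carrier K1 \<longleftrightarrow> f \<in> carrier F0 \<and> \<pi> f \<in> J" for f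
    using q_ker[of "\<pi> f"] linear_mapD(1)[OF \<pi>, of f] cover[of f]
    by (auto simp: K1_def syzygy_simps F0_def)
  define e where "e = unit_vector R (carrier N) (q \<one>)"
  have e: "e \<in> carrier F0" unfolding e_def F0_def by (rule A.R.unit_vector_closed)
  have q1: "q \<one> \<in> carrier N" using linear_mapD(1)[OF q, of \<one>] by simp
  have \<pi>e: "\<pi> e = \<one>"
    using RM.linear_extension_unit_vector[OF \<rho>' q1] by (simp add: \<pi>_def e_def \<rho>_def)
  have \<pi>ae: "\<pi> (a \<odot>\<^bsub>F0\<^esub> e) = a" if "a \<in> carrier R" for a
    using linear_mapD(3)[OF \<pi> that e] that by (simp add: \<pi>e)
  have JR: "j \<in> carrier R" if "j \<in> J" for j using ideal.Icarr[OF J that] .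
  have je: "j \<odot>\<^bsub>F0\<^esub> e \<in> carrier K1" if "j \<in> J" for j
    using that e JR by (simp add: K1_iff \<pi>ae)
  have K1_ops: "add K1 = add F0" "smult K1 = smult F0"
    by (simp_all add: K1_def F0_def syzygy_simps)
  have "(\<forall>g. linear_map R K1 A g \<longrightarrow> (\<exists>\<psi>. linear_map R F0 A \<psi> \<and> (\<forall>k\<in>carrier K1. \<psi> k = g k))) \<longleftrightarrow> ?ext"
  proof
    assume ext: "\<forall>g. linear_map R K1 A g \<longrightarrow> (\<exists>\<psi>. linear_map R F0 A \<psi> \<and> (\<forall>k\<in>carrier K1. \<psi> k = g k))"
    show ?ext
    proof (intro allI impI)
      fix \<phi> assume \<phi>: "linear_map R (ideal_as_module R J) A \<phi>"
      have "linear_map R K1 (ideal_as_module R J) \<pi>"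
        using linear_mapD[OF \<pi>] by (intro linear_mapI) (auto simp: K1_iff K1_ops)
      then obtain \<psi> where \<psi>: "linear_map R F0 A \<psi>" and eq: "\<forall>k\<in>carrier K1. \<psi> k = \<phi> (\<pi> k)"
        using ext linear_map_comp[OF _ \<phi>] by blast
      have "\<phi> j = j \<odot>\<^bsub>A\<^esub> \<psi> e" if j: "j \<in> J" for j
        using eq je[OF j] JR[OF j] linear_mapD(3)[OF \<psi> JR[OF j] e] by (simp add: \<pi>ae)
      then show "\<exists>y\<in>carrier A. \<forall>j\<in>J. \<phi> j = j \<odot>\<^bsub>A\<^esub> y"
        using linear_mapD(1)[OF \<psi> e] by blast
    qed
  next
    assume ext: ?ext
    show "\<forall>g. linear_map R K1 A g \<longrightarrow> (\<exists>\<psi>. linear_map R F0 A \<psi> \<and> (\<forall>k\<in>carrier K1. \<psi> k = g k))"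
    proof (intro allI impI)
      fix g assume g: "linear_map R K1 A g"
      have "linear_map R (ideal_as_module R J) A (\<lambda>j. g (j \<odot>\<^bsub>F0\<^esub> e))"
      proof (rule linear_mapI)
        fix i j assume ij: "i \<in> carrier (ideal_as_module R J)" "j \<in> carrier (ideal_as_module R J)"
        then have "(i \<oplus> j) \<odot>\<^bsub>F0\<^esub> e = i \<odot>\<^bsub>F0\<^esub> e \<oplus>\<^bsub>K1\<^esub> j \<odot>\<^bsub>F0\<^esub> e"
          using JR e by (simp add: K1_ops F0.smult_l_distr)
        then show "g ((i \<oplus>\<^bsub>ideal_as_module R J\<^esub> j) \<odot>\<^bsub>F0\<^esub> e) = g (i \<odot>\<^bsub>F0\<^esub> e) \<oplus>\<^bsub>A\<^esub> g (j \<odot>\<^bsub>F0\<^esub> e)"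
          using linear_mapD(2)[OF g] je ij by simp
      next
        fix a j assume aj: "a \<in> carrier R" "j \<in> carrier (ideal_as_module R J)"
        then have "(a \<otimes> j) \<odot>\<^bsub>F0\<^esub> e = a \<odot>\<^bsub>K1\<^esub> (j \<odot>\<^bsub>F0\<^esub> e)"
          using JR e by (simp add: K1_ops F0.smult_assoc1)
        then show "g ((a \<odot>\<^bsub>ideal_as_module R J\<^esub> j) \<odot>\<^bsub>F0\<^esub> e) = a \<odot>\<^bsub>A\<^esub> g (j \<odot>\<^bsub>F0\<^esub> e)"
          using linear_mapD(3)[OF g] je aj by simp
      qed (use linear_mapD(1)[OF g] je in auto)
      then obtain y where y: "y \<in> carrier A" and gy: "\<forall>j\<in>J. g (j \<odot>\<^bsub>F0\<^esub> e) = j \<odot>\<^bsub>A\<^esub> y"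
        using ext by blast
      \<comment> \<open>Subtracting \<open>\<pi> f e\<close> moves \<open>f\<close> into the kernel of \<open>\<pi>\<close>, hence into the syzygies.\<close>
      define \<tau> where "\<tau> f = f \<ominus>\<^bsub>F0\<^esub> \<pi> f \<odot>\<^bsub>F0\<^esub> e" for f
      have \<tau>F: "linear_map R F0 F0 \<tau>"
        unfolding \<tau>_def
        by (rule linear_map_diff[OF F0 F0 _ linear_map_comp[OF \<pi> F0.smult_right_linear[OF e]]])
           (simp add: linear_map_def)
      have \<pi>R: "\<pi> f \<in> carrier R" if "f \<in> carrier F0" for f
        using linear_mapD(1)[OF \<pi> that] by simp
      have "\<pi> (\<tau> f) = \<zero>" if f: "f \<in> carrier F0" for f
        using linear_map_minus[OF F0 R \<pi> f, of "\<pi> f \<odot>\<^bsub>F0\<^esub> e"] f e \<pi>R[OF f]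
        by (simp add: \<tau>_def \<pi>ae a_minus_def A.R.r_neg)
      then have \<tau>K: "linear_map R F0 K1 \<tau>"
        using linear_mapD[OF \<tau>F] additive_subgroup.zero_closed[OF ideal.axioms(1)[OF J]]
        by (intro linear_mapI) (simp_all add: K1_iff K1_ops)
      define \<psi> where "\<psi> f = g (\<tau> f) \<oplus>\<^bsub>A\<^esub> \<pi> f \<odot>\<^bsub>A\<^esub> y" for f
      have "linear_map R F0 A \<psi>"
        unfolding \<psi>_def
        by (rule linear_map_add[OF F0 A linear_map_comp[OF \<tau>K g]
              linear_map_comp[OF \<pi> A.smult_right_linear[OF y]]])
      moreover have "\<psi> k = g k" if k: "k \<in> carrier K1" for k
      proof -
        have kF: "k \<in> carrier F0" and kJ: "\<pi> k \<in> J" using k by (simp_all add: K1_iff)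
        have "\<psi> k = g (\<tau> k) \<oplus>\<^bsub>A\<^esub> g (\<pi> k \<odot>\<^bsub>F0\<^esub> e)" using gy kJ by (simp add: \<psi>_def)
        also have "\<dots> = g (\<tau> k \<oplus>\<^bsub>K1\<^esub> \<pi> k \<odot>\<^bsub>F0\<^esub> e)"
          using linear_mapD(2)[OF g] linear_mapD(1)[OF \<tau>K kF] je[OF kJ] by simp
        also have "\<tau> k \<oplus>\<^bsub>K1\<^esub> \<pi> k \<odot>\<^bsub>F0\<^esub> e = k"
          using kF e JR[OF kJ] by (simp add: \<tau>_def K1_ops a_minus_def F0.M.a_assoc F0.M.l_neg)
        finally show ?thesis .
      qed
      ultimately show "\<exists>\<psi>. linear_map R F0 A \<psi> \<and> (\<forall>k\<in>carrier K1. \<psi> k = g k)" by blast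
    qed
  qed
  then show ?thesis unfolding Ext1_trivial_iff[OF N A] K1_def F0_def .
qed

section \<open>GV-ideals\<close>

lemma (in cring) GV_ideal_imp_ideal: "GV_ideal R J \<Longrightarrow> ideal J R"
  by (auto simp: GV_ideal_def genideal_ideal)

text \<open>The isomorphism \<open>R \<rightarrow> Hom(J, R)\<close> splits into its injectivity, that \<open>J\<close> is faithful, and its
  surjectivity, that every linear map \<open>J \<rightarrow> R\<close> is a multiplication.\<close>

lemma (in cring) mult_map_iso_iff:
  assumes J: "ideal J R"
  shows "(\<lambda>r\<in>carrier R. \<lambda>x\<in>J. r \<otimes> x)
       \<in> module_iso R (ring_as_module R) (Hom_module R (ideal_as_module R J) (ring_as_module R)) \<longleftrightarrow>
     (\<forall>r\<in>carrier R. (\<forall>x\<in>J. r \<otimes> x = \<zero>) \<longrightarrow> r = \<zero>) \<and>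
     (\<forall>\<phi>. linear_map R (ideal_as_module R J) (ring_as_module R) \<phi> \<longrightarrow>
        (\<exists>r\<in>carrier R. \<forall>x\<in>J. \<phi> x = r \<otimes> x))"
    (is "?\<mu> \<in> module_iso R ?R ?H \<longleftrightarrow> ?inj \<and> ?surj")
proof -
  have JR: "x \<in> carrier R" if "x \<in> J" for x using ideal.Icarr[OF J that] .
  have JM: "module R (ideal_as_module R J)" by (rule ideal_as_module_module[OF J])
  have \<mu>: "(\<lambda>x\<in>J. r \<otimes> x) \<in> carrier ?H" if "r \<in> carrier R" for r
    using restrict_in_Hom_module[OF JM, of ?R "\<lambda>x. r \<otimes> x"] that JR
    by (simp add: linear_map_def r_distr m_lcomm)
  have "?\<mu> \<in> carrier (Hom_module R ?R ?H)"
  proof (unfold Hom_module_iff, intro conjI linear_mapI)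
    fix r assume r: "r \<in> carrier ?R"
    then show "?\<mu> r \<in> carrier ?H" using \<mu> by simp
    fix s assume s: "s \<in> carrier ?R"
    then show "?\<mu> (r \<oplus>\<^bsub>?R\<^esub> s) = ?\<mu> r \<oplus>\<^bsub>?H\<^esub> ?\<mu> s"
      using r JR by (simp add: Hom_module_def fun_eq_iff l_distr)
  next
    fix a r assume "a \<in> carrier R" "r \<in> carrier ?R"
    then show "?\<mu> (a \<odot>\<^bsub>?R\<^esub> r) = a \<odot>\<^bsub>?H\<^esub> ?\<mu> r"
      using JR by (simp add: Hom_module_def fun_eq_iff m_assoc)
  qed simp
  then have "?\<mu> \<in> module_iso R ?R ?H \<longleftrightarrow> inj_on ?\<mu> (carrier R) \<and> ?\<mu> ` carrier R = carrier ?H"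
    by (simp add: module_iso_def bij_betw_def)
  moreover have "inj_on ?\<mu> (carrier R) \<longleftrightarrow> ?inj"
  proof
    assume inj: "inj_on ?\<mu> (carrier R)"
    show ?inj
    proof (intro ballI impI)
      fix r assume r: "r \<in> carrier R" and "\<forall>x\<in>J. r \<otimes> x = \<zero>"
      then have "?\<mu> r = ?\<mu> \<zero>" using JR by (simp add: fun_eq_iff)
      then show "r = \<zero>" using inj r by (meson inj_onD zero_closed)
    qed
  next
    assume inj: ?inj
    show "inj_on ?\<mu> (carrier R)"
    proof (rule inj_onI)
      fix r s assume r: "r \<in> carrier R" and s: "s \<in> carrier R" and eq: "?\<mu> r = ?\<mu> s"
      have "(r \<ominus> s) \<otimes> x = \<zero>" if x: "x \<in> J" for x
      proof -
        have "r \<otimes> x = s \<otimes> x" using fun_cong[OF eq, of x] r s x by simp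
        then show ?thesis using r s JR[OF x] by (simp add: minus_eq l_distr l_minus r_neg)
      qed
      then have "r \<ominus> s = \<zero>" using inj r s by simp
      then show "r = s" using r s minus_eq_zero_iff by blast
    qed
  qed
  moreover have "?\<mu> ` carrier R = carrier ?H \<longleftrightarrow> ?surj"
  proof
    assume eq: "?\<mu> ` carrier R = carrier ?H"
    show ?surj
    proof (intro allI impI)
      fix \<phi> assume "linear_map R (ideal_as_module R J) ?R \<phi>"
      from restrict_in_Hom_module[OF JM this] have "restrict \<phi> J \<in> ?\<mu> ` carrier R" using eq by simp
      then obtain r where r: "r \<in> carrier R" "restrict \<phi> J = ?\<mu> r" by blast
      have "\<phi> x = r \<otimes> x" if "x \<in> J" for x using fun_cong[OF r(2), of x] r(1) that by simp
      then show "\<exists>r\<in>carrier R. \<forall>x\<in>J. \<phi> x = r \<otimes> x" using r(1) by blast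
    qed
  next
    assume surj: ?surj
    show "?\<mu> ` carrier R = carrier ?H"
    proof
      show "?\<mu> ` carrier R \<subseteq> carrier ?H" using \<mu> by auto
      show "carrier ?H \<subseteq> ?\<mu> ` carrier R"
      proof
        fix \<phi> assume "\<phi> \<in> carrier ?H"
        then have \<phi>: "linear_map R (ideal_as_module R J) ?R \<phi>" and ext: "\<phi> \<in> extensional J"
          by (simp_all add: Hom_module_iff)
        then obtain r where r: "r \<in> carrier R" "\<forall>x\<in>J. \<phi> x = r \<otimes> x" using surj by blast
        have "\<phi> x = ?\<mu> r x" for x using r ext by (simp add: extensional_def)
        then show "\<phi> \<in> ?\<mu> ` carrier R" using r(1) by blast
      qed
    qed
  qed
  ultimately show ?thesis by simp
qed

lemma (in cring) GV_ideal_iff: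
  "GV_ideal R J \<longleftrightarrow> (\<exists>S. finite S \<and> S \<subseteq> carrier R \<and> J = Idl S) \<and>
     (\<forall>r\<in>carrier R. (\<forall>x\<in>J. r \<otimes> x = \<zero>) \<longrightarrow> r = \<zero>) \<and>
     (\<forall>\<phi>. linear_map R (ideal_as_module R J) (ring_as_module R) \<phi> \<longrightarrow>
        (\<exists>r\<in>carrier R. \<forall>x\<in>J. \<phi> x = r \<otimes> x))"
  unfolding GV_ideal_def using mult_map_iso_iff genideal_ideal by blast

lemma (in cring) GV_ideal_fg:
  assumes "GV_ideal R J"
  obtains S where "finite S" "S \<subseteq> carrier R" "J = Idl S"
  using assms by (auto simp: GV_ideal_iff)

lemma (in cring) GV_ideal_faithful:
  "GV_ideal R J \<Longrightarrow> r \<in> carrier R \<Longrightarrow> (\<And>x. x \<in> J \<Longrightarrow> r \<otimes> x = \<zero>) \<Longrightarrow> r = \<zero>"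
  unfolding GV_ideal_iff by blast

lemma (in cring) GV_ideal_linear_map:
  assumes "GV_ideal R J" and "linear_map R (ideal_as_module R J) (ring_as_module R) \<phi>"
  obtains r where "r \<in> carrier R" "\<And>x. x \<in> J \<Longrightarrow> \<phi> x = r \<otimes> x"
  using assms unfolding GV_ideal_iff by blast

lemma (in cring) GV_ideal_carrier: "GV_ideal R (carrier R)"
  unfolding GV_ideal_iff
proof (intro conjI allI impI ballI)
  show "\<exists>S. finite S \<and> S \<subseteq> carrier R \<and> carrier R = Idl S"
    using genideal_one by (intro exI[of _ "{\<one>}"]) simp
  fix r assume "r \<in> carrier R" "\<forall>x\<in>carrier R. r \<otimes> x = \<zero>"
  then show "r = \<zero>" by (metis one_closed r_one)
next
  fix \<phi> assume \<phi>: "linear_map R (ideal_as_module R (carrier R)) (ring_as_module R) \<phi>"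
  have "\<phi> \<one> \<in> carrier R" using linear_mapD(1)[OF \<phi>, of \<one>] by simp
  moreover have "\<phi> x = \<phi> \<one> \<otimes> x" if "x \<in> carrier R" for x
    using linear_mapD(3)[OF \<phi>, of x \<one>] that calculation by (simp add: m_comm)
  ultimately show "\<exists>r\<in>carrier R. \<forall>x\<in>carrier R. \<phi> x = r \<otimes> x" by blast
qed

lemma (in module) colon_ideal:
  assumes T: "submodule T R M" and x: "x \<in> carrier M"
  shows "ideal {r \<in> carrier R. r \<odot>\<^bsub>M\<^esub> x \<in> T} R"
  using submodule_vimage[OF R.ring_as_module_module module_axioms smult_right_linear[OF x] T]
  by (simp add: R.submodule_ring_as_module_iff)

lemma (in module) Idl_smult_mem:
  assumes T: "submodule T R M" and x: "x \<in> carrier M" and S: "S \<subseteq> carrier R"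
    and gen: "\<And>s. s \<in> S \<Longrightarrow> s \<odot>\<^bsub>M\<^esub> x \<in> T" and a: "a \<in> Idl S"
  shows "a \<odot>\<^bsub>M\<^esub> x \<in> T"
  using R.genideal_minimal[OF colon_ideal[OF T x], of S] gen S a by blast

lemma (in cring) Idl_mult_mem:
  assumes "ideal I R" and "x \<in> carrier R" and "S \<subseteq> carrier R"
    and "\<And>s. s \<in> S \<Longrightarrow> s \<otimes> x \<in> I" and "a \<in> Idl S"
  shows "a \<otimes> x \<in> I"
proof -
  interpret RM: module R "ring_as_module R" by (rule ring_as_module_module)
  show ?thesis
    using RM.Idl_smult_mem[of I x S a] assms by (simp add: submodule_ring_as_module_iff)
qed

text \<open>Given a linear map \<open>\<phi>\<close> on the product ideal and \<open>a \<in> J\<close>, the map \<open>b \<mapsto> \<phi> (a b)\<close> on \<open>K\<close> is multiplication by some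
  \<open>r a\<close>. As \<open>K\<close> is faithful, \<open>r a\<close> is unique and therefore linear in \<open>a\<close>, so \<open>r\<close> is itself multiplication by
  some \<open>s\<close>, and \<open>\<phi>\<close> agrees with multiplication by \<open>s\<close> on the generators \<open>a b\<close>.\<close>

lemma (in cring) GV_ideal_mult:
  assumes J: "GV_ideal R J" and K: "GV_ideal R K"
  shows "GV_ideal R (Idl (J <#> K))"
proof -
  have Ji: "ideal J R" and Ki: "ideal K R" using J K GV_ideal_imp_ideal by auto
  have JR: "a \<in> carrier R" if "a \<in> J" for a using ideal.Icarr[OF Ji that] .
  have KR: "a \<in> carrier R" if "a \<in> K" for a using ideal.Icarr[OF Ki that] .
  obtain S where S: "finite S" "S \<subseteq> carrier R" "J = Idl S" using GV_ideal_fg[OF J] .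
  obtain T where T: "finite T" "T \<subseteq> carrier R" "K = Idl T" using GV_ideal_fg[OF K] .
  let ?P = "Idl (J <#> K)"
  have JK: "J <#> K \<subseteq> carrier R" using JR KR by (auto simp: set_mult_def)
  have P: "ideal ?P R" by (rule genideal_ideal[OF JK])
  have prod: "a \<otimes> b \<in> ?P" if "a \<in> J" "b \<in> K" for a b
    using genideal_self[OF JK] that by (auto simp: set_mult_def)
  have PR: "x \<in> carrier R" if "x \<in> ?P" for x using ideal.Icarr[OF P that] .
  have ST: "S <#> T \<subseteq> carrier R" using S T by (auto simp: set_mult_def)
  have Pgen: "?P = Idl (S <#> T)"
  proof
    have I: "ideal (Idl (S <#> T)) R" by (rule genideal_ideal[OF ST])
    have "a \<otimes> b \<in> Idl (S <#> T)" if a: "a \<in> J" and b: "b \<in> K" for a b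
    proof -
      have "s \<otimes> t \<in> Idl (S <#> T)" if "s \<in> S" "t \<in> T" for s t
        using genideal_self[OF ST] that by (auto simp: set_mult_def)
      then have "a \<otimes> t \<in> Idl (S <#> T)" if "t \<in> T" for t
        using Idl_mult_mem[OF I _ S(2), of t a] that a S T by blast
      then have "t \<otimes> a \<in> Idl (S <#> T)" if "t \<in> T" for t
        using that T(2) JR[OF a] by (metis m_comm subsetD)
      then have "b \<otimes> a \<in> Idl (S <#> T)"
        using Idl_mult_mem[OF I _ T(2), of a b] JR[OF a] b T by blast
      then show ?thesis using JR[OF a] KR[OF b] by (simp add: m_comm)
    qed
    then show "?P \<subseteq> Idl (S <#> T)" by (intro genideal_minimal[OF I]) (auto simp: set_mult_def)
    have "S <#> T \<subseteq> ?P"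
      using prod genideal_self[OF S(2)] genideal_self[OF T(2)] S(3) T(3) by (auto simp: set_mult_def)
    then show "Idl (S <#> T) \<subseteq> ?P" by (rule genideal_minimal[OF P])
  qed
  show ?thesis
    unfolding GV_ideal_iff
  proof (intro conjI allI impI ballI)
    have "S <#> T = (\<lambda>(s, t). s \<otimes> t) ` (S \<times> T)" by (auto simp: set_mult_def)
    then have "finite (S <#> T)" using S T by simp
    then show "\<exists>U. finite U \<and> U \<subseteq> carrier R \<and> ?P = Idl U" using Pgen ST by blast
  next
    fix r assume r: "r \<in> carrier R" and ann: "\<forall>x\<in>?P. r \<otimes> x = \<zero>"
    show "r = \<zero>"
    proof (rule GV_ideal_faithful[OF J r])
      fix a assume a: "a \<in> J"
      show "r \<otimes> a = \<zero>"
        by (rule GV_ideal_faithful[OF K]) (use r JR[OF a] KR ann prod[OF a] in \<open>simp_all add: m_assoc\<close>)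
    qed
  next
    fix \<phi> assume \<phi>: "linear_map R (ideal_as_module R ?P) (ring_as_module R) \<phi>"
    note \<phi>D = linear_mapD[OF \<phi>, simplified]
    have "\<exists>r. r \<in> carrier R \<and> (\<forall>b\<in>K. \<phi> (a \<otimes> b) = r \<otimes> b)" if a: "a \<in> J" for a
    proof -
      have "linear_map R (ideal_as_module R K) (ring_as_module R) (\<lambda>b. \<phi> (a \<otimes> b))"
        using \<phi>D(1) \<phi>D(2)[of "a \<otimes> b" "a \<otimes> c" for b c] \<phi>D(3)[of c "a \<otimes> b" for b c] prod[OF a] JR[OF a] KR
        by (intro linear_mapI) (simp_all add: r_distr m_lcomm)
      then show ?thesis using GV_ideal_linear_map[OF K] by metis
    qed
    then obtain r where r: "r a \<in> carrier R" and r_eq: "\<forall>b\<in>K. \<phi> (a \<otimes> b) = r a \<otimes> b" if "a \<in> J" for a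
      by metis
    have r_unique: "r a = s" if a: "a \<in> J" and s: "s \<in> carrier R" and eq: "\<And>b. b \<in> K \<Longrightarrow> \<phi> (a \<otimes> b) = s \<otimes> b" for a s
    proof -
      have "r a \<ominus> s = \<zero>"
        by (rule GV_ideal_faithful[OF K])
           (use r[OF a] r_eq[OF a] s eq KR in \<open>simp_all add: minus_eq l_distr l_minus r_neg\<close>)
      then show ?thesis using r[OF a] s minus_eq_zero_iff by blast
    qed
    have "linear_map R (ideal_as_module R J) (ring_as_module R) r"
    proof (rule linear_mapI)
      fix a b assume a: "a \<in> carrier (ideal_as_module R J)" and b: "b \<in> carrier (ideal_as_module R J)"
      have ab: "a \<oplus> b \<in> J" using a b additive_subgroup.a_closed[OF ideal.axioms(1)[OF Ji]] by simp
      show "r (a \<oplus>\<^bsub>ideal_as_module R J\<^esub> b) = r a \<oplus>\<^bsub>ring_as_module R\<^esub> r b"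
      proof (simp, rule r_unique[OF ab])
        show "r a \<oplus> r b \<in> carrier R" using r a b by simp
        fix c assume c: "c \<in> K"
        have "\<phi> ((a \<oplus> b) \<otimes> c) = \<phi> (a \<otimes> c \<oplus> b \<otimes> c)"
          using JR a b KR[OF c] by (simp add: l_distr)
        also have "\<dots> = r a \<otimes> c \<oplus> r b \<otimes> c"
          using \<phi>D(2)[OF prod prod] a b c r_eq by simp
        also have "\<dots> = (r a \<oplus> r b) \<otimes> c" using r a b KR[OF c] by (simp add: l_distr)
        finally show "\<phi> ((a \<oplus> b) \<otimes> c) = (r a \<oplus> r b) \<otimes> c" .
      qed
    next
      fix c a assume c: "c \<in> carrier R" and a: "a \<in> carrier (ideal_as_module R J)"
      have ca: "c \<otimes> a \<in> J" using a c ideal.I_l_closed[OF Ji] by simp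
      show "r (c \<odot>\<^bsub>ideal_as_module R J\<^esub> a) = c \<odot>\<^bsub>ring_as_module R\<^esub> r a"
      proof (simp, rule r_unique[OF ca])
        show "c \<otimes> r a \<in> carrier R" using r a c by simp
        fix b assume b: "b \<in> K"
        have "\<phi> (c \<otimes> a \<otimes> b) = \<phi> (c \<otimes> (a \<otimes> b))"
          using JR a c KR[OF b] by (simp add: m_assoc)
        also have "\<dots> = c \<otimes> (r a \<otimes> b)"
          using \<phi>D(3)[OF c prod] a b r_eq by simp
        also have "\<dots> = c \<otimes> r a \<otimes> b" using r a c KR[OF b] by (simp add: m_assoc)
        finally show "\<phi> (c \<otimes> a \<otimes> b) = c \<otimes> r a \<otimes> b" .
      qed
    qed (use r in auto)
    then obtain s where s: "s \<in> carrier R" "\<And>a. a \<in> J \<Longrightarrow> r a = s \<otimes> a"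
      using GV_ideal_linear_map[OF J] by blast
    interpret PM: module R "ideal_as_module R ?P" by (rule ideal_as_module_module[OF P])
    have "linear_map R (ideal_as_module R ?P) (ring_as_module R) (\<lambda>x. s \<otimes> x)"
      using s(1) PR by (intro linear_mapI) (simp_all add: r_distr m_lcomm)
    from submodule_equalizer[OF PM.module_axioms ring_as_module_module \<phi> this]
    have "submodule {x \<in> ?P. \<phi> x = s \<otimes> x} R (ideal_as_module R ?P)" by simp
    note eq = PM.submoduleE[OF this, simplified] PM.submodule_zero[OF this, simplified]
    interpret RM: module R "ring_as_module R" by (rule ring_as_module_module)
    have "submodule {x \<in> ?P. \<phi> x = s \<otimes> x} R (ring_as_module R)"
      using eq PR by (intro RM.submoduleI') auto
    then have "ideal {x \<in> ?P. \<phi> x = s \<otimes> x} R" by (simp add: submodule_ring_as_module_iff)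
    moreover have "J <#> K \<subseteq> {x \<in> ?P. \<phi> x = s \<otimes> x}"
      using prod r_eq s JR KR by (auto simp: set_mult_def m_assoc)
    ultimately have "?P \<subseteq> {x \<in> ?P. \<phi> x = s \<otimes> x}" by (rule genideal_minimal)
    then show "\<exists>s\<in>carrier R. \<forall>x\<in>?P. \<phi> x = s \<otimes> x" using s(1) by blast
  qed
qed

section \<open>The GV-closure of a submodule\<close>

text \<open>For a submodule \<open>T\<close> this is the preimage in \<open>M\<close> of the \<open>GV\<close>-torsion submodule of \<open>M/T\<close>. Working with it
  avoids quotients: \<open>N/T\<close> is \<open>GV\<close>-torsion iff \<open>N\<close> is contained in the closure of \<open>T\<close>.\<close>

definition GV_closure :: "('a, 'b) ring_scheme \<Rightarrow> ('a, 'm, 'c) module_scheme \<Rightarrow> 'm set \<Rightarrow> 'm set" where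
  "GV_closure R M T = {x \<in> carrier M. \<exists>J. GV_ideal R J \<and> (\<forall>a\<in>J. a \<odot>\<^bsub>M\<^esub> x \<in> T)}"

lemma GV_closureI:
  "x \<in> carrier M \<Longrightarrow> GV_ideal R J \<Longrightarrow> (\<And>a. a \<in> J \<Longrightarrow> a \<odot>\<^bsub>M\<^esub> x \<in> T) \<Longrightarrow> x \<in> GV_closure R M T"
  by (auto simp: GV_closure_def)

lemma GV_closureE:
  assumes "x \<in> GV_closure R M T"
  obtains J where "x \<in> carrier M" "GV_ideal R J" "\<And>a. a \<in> J \<Longrightarrow> a \<odot>\<^bsub>M\<^esub> x \<in> T"
  using assms by (auto simp: GV_closure_def)

lemma GV_closure_mono: "T \<subseteq> T' \<Longrightarrow> GV_closure R M T \<subseteq> GV_closure R M T'"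
  by (auto simp: GV_closure_def)

context module
begin

lemma GV_closure_increasing:
  assumes "submodule T R M"
  shows "T \<subseteq> GV_closure R M T"
  using submoduleE(1,4)[OF assms] by (auto intro: GV_closureI[OF _ R.GV_ideal_carrier])

lemma GV_closure_mult:
  assumes T: "submodule T R M" and J: "GV_ideal R J" and K: "GV_ideal R K" and x: "x \<in> carrier M"
    and JK: "\<And>a b. a \<in> J \<Longrightarrow> b \<in> K \<Longrightarrow> (a \<otimes> b) \<odot>\<^bsub>M\<^esub> x \<in> T"
    and c: "c \<in> Idl (J <#> K)"
  shows "c \<odot>\<^bsub>M\<^esub> x \<in> T"
proof -
  have "J <#> K \<subseteq> carrier R"
    using ideal.Icarr[OF R.GV_ideal_imp_ideal[OF J]] ideal.Icarr[OF R.GV_ideal_imp_ideal[OF K]]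
    by (auto simp: set_mult_def)
  from Idl_smult_mem[OF T x this _ c] show ?thesis using JK by (auto simp: set_mult_def)
qed

text \<open>A single \<open>GV\<close>-ideal works for finitely many elements at once, namely the product of their ideals.\<close>

lemma GV_closure_finite:
  assumes T: "submodule T R M" and "finite Y" and "Y \<subseteq> GV_closure R M T"
  shows "\<exists>J. GV_ideal R J \<and> (\<forall>y\<in>Y. \<forall>a\<in>J. a \<odot>\<^bsub>M\<^esub> y \<in> T)"
  using assms(2,3)
proof (induction Y rule: finite_induct)
  case empty
  then show ?case using R.GV_ideal_carrier by blast
next
  case (insert y Y)
  obtain J where J: "GV_ideal R J" and JY: "\<And>z a. z \<in> Y \<Longrightarrow> a \<in> J \<Longrightarrow> a \<odot>\<^bsub>M\<^esub> z \<in> T" using insert by blast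
  from insert.prems have "y \<in> GV_closure R M T" by simp
  then obtain K where y: "y \<in> carrier M" and K: "GV_ideal R K" and Ky: "\<And>a. a \<in> K \<Longrightarrow> a \<odot>\<^bsub>M\<^esub> y \<in> T"
    by (rule GV_closureE) blast
  have JR: "a \<in> carrier R" if "a \<in> J" for a using ideal.Icarr[OF R.GV_ideal_imp_ideal[OF J] that] .
  have KR: "a \<in> carrier R" if "a \<in> K" for a using ideal.Icarr[OF R.GV_ideal_imp_ideal[OF K] that] .
  have "c \<odot>\<^bsub>M\<^esub> z \<in> T" if z: "z \<in> insert y Y" and c: "c \<in> Idl (J <#> K)" for z c
  proof -
    have zM: "z \<in> carrier M" using z insert.prems by (auto simp: GV_closure_def)
    have "(a \<otimes> b) \<odot>\<^bsub>M\<^esub> z \<in> T" if a: "a \<in> J" and b: "b \<in> K" for a b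
    proof (cases "z = y")
      case True
      then show ?thesis using Ky[OF b] JR[OF a] KR[OF b] y submoduleE(4)[OF T] by (simp add: smult_assoc1)
    next
      case False
      then have "b \<odot>\<^bsub>M\<^esub> (a \<odot>\<^bsub>M\<^esub> z) \<in> T" using JY a z KR[OF b] submoduleE(4)[OF T] by blast
      moreover have "(a \<otimes> b) \<odot>\<^bsub>M\<^esub> z = b \<odot>\<^bsub>M\<^esub> (a \<odot>\<^bsub>M\<^esub> z)"
        using JR[OF a] KR[OF b] zM by (metis smult_assoc1 R.m_comm)
      ultimately show ?thesis by simp
    qed
    then show ?thesis using GV_closure_mult[OF T J K zM _ c] by blast
  qed
  then show ?case using R.GV_ideal_mult[OF J K] by blast
qed

lemma GV_closure_submodule:
  assumes T: "submodule T R M"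
  shows "submodule (GV_closure R M T) R M"
proof (rule submoduleI')
  show "GV_closure R M T \<subseteq> carrier M" by (auto simp: GV_closure_def)
  show "\<zero>\<^bsub>M\<^esub> \<in> GV_closure R M T" using GV_closure_increasing[OF T] submodule_zero[OF T] by blast
next
  fix x y assume x: "x \<in> GV_closure R M T" and y: "y \<in> GV_closure R M T"
  then obtain J where J: "GV_ideal R J" "\<And>a. a \<in> J \<Longrightarrow> a \<odot>\<^bsub>M\<^esub> x \<in> T" "\<And>a. a \<in> J \<Longrightarrow> a \<odot>\<^bsub>M\<^esub> y \<in> T"
    using GV_closure_finite[OF T, of "{x, y}"] by auto
  have xy: "x \<in> carrier M" "y \<in> carrier M" using x y by (auto simp: GV_closure_def)
  show "x \<oplus>\<^bsub>M\<^esub> y \<in> GV_closure R M T"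
    by (rule GV_closureI[OF _ J(1)])
       (use xy J ideal.Icarr[OF R.GV_ideal_imp_ideal[OF J(1)]] submoduleE(5)[OF T] in
         \<open>simp_all add: smult_r_distr\<close>)
next
  fix c x assume c: "c \<in> carrier R"
  assume "x \<in> GV_closure R M T"
  then obtain J where x: "x \<in> carrier M" and J: "GV_ideal R J" and Jx: "\<And>a. a \<in> J \<Longrightarrow> a \<odot>\<^bsub>M\<^esub> x \<in> T"
    by (rule GV_closureE) blast
  have "a \<odot>\<^bsub>M\<^esub> (c \<odot>\<^bsub>M\<^esub> x) \<in> T" if a: "a \<in> J" for a
  proof -
    have "a \<in> carrier R" using ideal.Icarr[OF R.GV_ideal_imp_ideal[OF J] a] .
    then have "a \<odot>\<^bsub>M\<^esub> (c \<odot>\<^bsub>M\<^esub> x) = c \<odot>\<^bsub>M\<^esub> (a \<odot>\<^bsub>M\<^esub> x)" using c x by (metis smult_assoc1 R.m_comm)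
    then show ?thesis using Jx[OF a] c submoduleE(4)[OF T] by simp
  qed
  then show "c \<odot>\<^bsub>M\<^esub> x \<in> GV_closure R M T" using c x by (intro GV_closureI[OF _ J]) auto
qed

text \<open>If \<open>J x\<close> lies in the closure, one \<open>GV\<close>-ideal \<open>K\<close> carries the multiples of \<open>x\<close> by the finitely many generators
  of \<open>J\<close> into \<open>T\<close>; then \<open>J K x \<subseteq> T\<close>.\<close>

lemma GV_closure_idem:
  assumes T: "submodule T R M"
  shows "GV_closure R M (GV_closure R M T) \<subseteq> GV_closure R M T"
proof
  fix x assume "x \<in> GV_closure R M (GV_closure R M T)"
  then obtain J where x: "x \<in> carrier M" and J: "GV_ideal R J"
    and Jx: "\<And>a. a \<in> J \<Longrightarrow> a \<odot>\<^bsub>M\<^esub> x \<in> GV_closure R M T"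
    by (rule GV_closureE) blast
  obtain S where S: "finite S" "S \<subseteq> carrier R" "J = Idl S" using R.GV_ideal_fg[OF J] .
  have "(\<lambda>s. s \<odot>\<^bsub>M\<^esub> x) ` S \<subseteq> GV_closure R M T" using Jx S R.genideal_self[OF S(2)] by blast
  with GV_closure_finite[OF T, of "(\<lambda>s. s \<odot>\<^bsub>M\<^esub> x) ` S"] S(1)
  obtain K where K: "GV_ideal R K" and KS: "\<And>s a. s \<in> S \<Longrightarrow> a \<in> K \<Longrightarrow> a \<odot>\<^bsub>M\<^esub> (s \<odot>\<^bsub>M\<^esub> x) \<in> T" by auto
  have KR: "a \<in> carrier R" if "a \<in> K" for a using ideal.Icarr[OF R.GV_ideal_imp_ideal[OF K] that] .
  have JR: "a \<in> carrier R" if "a \<in> J" for a using ideal.Icarr[OF R.GV_ideal_imp_ideal[OF J] that] .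
  have comm: "b \<odot>\<^bsub>M\<^esub> (a \<odot>\<^bsub>M\<^esub> x) = a \<odot>\<^bsub>M\<^esub> (b \<odot>\<^bsub>M\<^esub> x)" if "a \<in> carrier R" "b \<in> carrier R" for a b
    using that x by (metis smult_assoc1 R.m_comm)
  have JKx: "(a \<otimes> b) \<odot>\<^bsub>M\<^esub> x \<in> T" if a: "a \<in> J" and b: "b \<in> K" for a b
  proof -
    have "a \<odot>\<^bsub>M\<^esub> (b \<odot>\<^bsub>M\<^esub> x) \<in> T"
    proof (rule Idl_smult_mem[OF T _ S(2)])
      show "s \<odot>\<^bsub>M\<^esub> (b \<odot>\<^bsub>M\<^esub> x) \<in> T" if "s \<in> S" for s
        using KS[OF that b] comm[of s b] KR[OF b] S(2) that by auto
    qed (use KR[OF b] x a S in auto)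
    then show ?thesis using JR[OF a] KR[OF b] x by (simp add: smult_assoc1)
  qed
  show "x \<in> GV_closure R M T"
    by (rule GV_closureI[OF x R.GV_ideal_mult[OF J K]]) (rule GV_closure_mult[OF T J K x JKx])
qed

lemma submodule_chain_Union:
  assumes chain: "subset.chain {N. submodule N R M} \<C>" and "\<C> \<noteq> {}"
  shows "submodule (\<Union>\<C>) R M"
proof (rule submoduleI')
  have sub: "submodule N R M" if "N \<in> \<C>" for N using chain that by (auto simp: subset.chain_def)
  show "\<Union>\<C> \<subseteq> carrier M" using sub submoduleE(1) by blast
  show "\<zero>\<^bsub>M\<^esub> \<in> \<Union>\<C>" using assms(2) sub submodule_zero by blast
  fix x y assume "x \<in> \<Union>\<C>" "y \<in> \<Union>\<C>"
  then have xy: "finite {x, y}" "{x, y} \<subseteq> \<Union>\<C>" by auto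
  obtain N where "N \<in> \<C>" "{x, y} \<subseteq> N" using finite_subset_Union_chain[OF xy assms(2) chain] .
  then have "x \<oplus>\<^bsub>M\<^esub> y \<in> N" using submoduleE(5)[OF sub] by simp
  then show "x \<oplus>\<^bsub>M\<^esub> y \<in> \<Union>\<C>" using \<open>N \<in> \<C>\<close> by blast
next
  have sub: "submodule N R M" if "N \<in> \<C>" for N using chain that by (auto simp: subset.chain_def)
  fix a x assume "a \<in> carrier R" "x \<in> \<Union>\<C>"
  then show "a \<odot>\<^bsub>M\<^esub> x \<in> \<Union>\<C>" using sub submoduleE(4) by blast
qed

end

section \<open>Prime and maximal \<open>w\<close>-ideals\<close>

text \<open>If \<open>I\<close> is a \<open>w\<close>-ideal and \<open>J x \<subseteq> I\<close>, the map \<open>j \<mapsto> j x\<close> from \<open>J\<close> to \<open>I\<close> equals \<open>j \<mapsto> j y\<close> for some \<open>y \<in> I\<close>, and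
  \<open>x = y\<close> because \<open>J\<close> is faithful. Conversely a linear map \<open>J \<rightarrow> I \<subseteq> R\<close> is multiplication by some \<open>r \<in> R\<close>, and
  \<open>J r \<subseteq> I\<close> puts \<open>r\<close> into the closed ideal \<open>I\<close>. The \<open>GV\<close>-torsion-freeness of \<open>I\<close> is inherited from \<open>R\<close>.\<close>

lemma (in cring) w_ideal_iff:
  "w_ideal R I \<longleftrightarrow> ideal I R \<and> GV_closure R (ring_as_module R) I \<subseteq> I"
proof (cases "ideal I R")
  case False
  then show ?thesis by (simp add: w_ideal_def)
next
  case True
  let ?I = "ideal_as_module R I"
  have IM: "module R ?I" by (rule ideal_as_module_module[OF True])
  have IR: "x \<in> carrier R" if "x \<in> I" for x using ideal.Icarr[OF True that] .
  have zeroI: "\<zero> \<in> I" using additive_subgroup.zero_closed[OF ideal.axioms(1)[OF True]] .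
  have JR: "a \<in> carrier R" if "GV_ideal R J" "a \<in> J" for J a
    using ideal.Icarr[OF GV_ideal_imp_ideal[OF that(1)] that(2)] .
  have "tor_GV R ?I = {\<zero>\<^bsub>?I\<^esub>}"
  proof
    show "{\<zero>\<^bsub>?I\<^esub>} \<subseteq> tor_GV R ?I" using zeroI GV_ideal_carrier by (auto simp: tor_GV_def)
    show "tor_GV R ?I \<subseteq> {\<zero>\<^bsub>?I\<^esub>}"
    proof
      fix x assume "x \<in> tor_GV R ?I"
      then obtain J where x: "x \<in> I" and J: "GV_ideal R J" and Jx: "\<forall>a\<in>J. a \<otimes> x = \<zero>"
        by (auto simp: tor_GV_def)
      have "x = \<zero>"
        by (rule GV_ideal_faithful[OF J IR[OF x]]) (use Jx JR[OF J] IR[OF x] in \<open>simp add: m_comm\<close>)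
      then show "x \<in> {\<zero>\<^bsub>?I\<^esub>}" by simp
    qed
  qed
  then have "w_ideal R I \<longleftrightarrow> (\<forall>J. GV_ideal R J \<longrightarrow>
      (\<forall>\<phi>. linear_map R (ideal_as_module R J) ?I \<phi> \<longrightarrow> (\<exists>y\<in>I. \<forall>j\<in>J. \<phi> j = j \<otimes> y)))"
    using True Ext1_cyclic_trivial_iff[OF GV_ideal_imp_ideal IM]
    by (simp add: w_ideal_def w_module_def GV_torsion_free_def Let_def)
  also have "\<dots> \<longleftrightarrow> GV_closure R (ring_as_module R) I \<subseteq> I"
  proof
    assume ext: "\<forall>J. GV_ideal R J \<longrightarrow>
      (\<forall>\<phi>. linear_map R (ideal_as_module R J) ?I \<phi> \<longrightarrow> (\<exists>y\<in>I. \<forall>j\<in>J. \<phi> j = j \<otimes> y))"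
    show "GV_closure R (ring_as_module R) I \<subseteq> I"
    proof
      fix x assume "x \<in> GV_closure R (ring_as_module R) I"
      then obtain J where x: "x \<in> carrier R" and J: "GV_ideal R J" and Jx: "\<And>a. a \<in> J \<Longrightarrow> a \<otimes> x \<in> I"
        by (auto elim: GV_closureE)
      have "linear_map R (ideal_as_module R J) ?I (\<lambda>a. a \<otimes> x)"
        using x Jx JR[OF J] by (intro linear_mapI) (simp_all add: l_distr m_assoc)
      then obtain y where y: "y \<in> I" and eq: "\<forall>j\<in>J. j \<otimes> x = j \<otimes> y" using ext J by blast
      have "x \<ominus> y = \<zero>"
      proof (rule GV_ideal_faithful[OF J])
        fix j assume j: "j \<in> J"
        have "(x \<ominus> y) \<otimes> j = j \<otimes> x \<ominus> j \<otimes> y"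
          using x IR[OF y] JR[OF J j] m_comm[of "x \<ominus> y" j] by (simp add: minus_eq r_distr r_minus)
        also have "\<dots> = \<zero>" using eq j IR[OF y] JR[OF J j] by (simp add: minus_eq r_neg)
        finally show "(x \<ominus> y) \<otimes> j = \<zero>" .
      qed (use x IR[OF y] in simp)
      then have "x = y" using minus_eq_zero_iff[OF x IR[OF y]] by simp
      then show "x \<in> I" using y by simp
    qed
  next
    assume cl: "GV_closure R (ring_as_module R) I \<subseteq> I"
    show "\<forall>J. GV_ideal R J \<longrightarrow>
      (\<forall>\<phi>. linear_map R (ideal_as_module R J) ?I \<phi> \<longrightarrow> (\<exists>y\<in>I. \<forall>j\<in>J. \<phi> j = j \<otimes> y))"
    proof (intro allI impI)
      fix J \<phi> assume J: "GV_ideal R J" and \<phi>: "linear_map R (ideal_as_module R J) ?I \<phi>"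
      have "linear_map R (ideal_as_module R J) (ring_as_module R) \<phi>"
        using linear_mapD[OF \<phi>] IR by (intro linear_mapI) auto
      then obtain r where r: "r \<in> carrier R" and eq: "\<And>x. x \<in> J \<Longrightarrow> \<phi> x = r \<otimes> x"
        using GV_ideal_linear_map[OF J] by blast
      have eq': "\<phi> x = x \<otimes> r" if "x \<in> J" for x using eq[OF that] r JR[OF J that] by (simp add: m_comm)
      have "r \<in> GV_closure R (ring_as_module R) I"
        using r eq' linear_mapD(1)[OF \<phi>] by (intro GV_closureI[OF _ J]) (auto simp flip: eq')
      then show "\<exists>y\<in>I. \<forall>j\<in>J. \<phi> j = j \<otimes> y" using cl eq' by blast
    qed
  qed
  finally show ?thesis using True by simp
qed

lemma (in cring) w_ideal_colon:
  assumes I: "w_ideal R I" and a: "a \<in> carrier R"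
  shows "w_ideal R {r \<in> carrier R. r \<otimes> a \<in> I}"
  unfolding w_ideal_iff
proof
  interpret RM: module R "ring_as_module R" by (rule ring_as_module_module)
  have Ii: "ideal I R" and cl: "GV_closure R (ring_as_module R) I \<subseteq> I" using I by (auto simp: w_ideal_iff)
  show "ideal {r \<in> carrier R. r \<otimes> a \<in> I} R"
    using RM.colon_ideal[of I a] a Ii by (simp add: submodule_ring_as_module_iff)
  show "GV_closure R (ring_as_module R) {r \<in> carrier R. r \<otimes> a \<in> I} \<subseteq> {r \<in> carrier R. r \<otimes> a \<in> I}"
  proof
    fix r assume "r \<in> GV_closure R (ring_as_module R) {r \<in> carrier R. r \<otimes> a \<in> I}"
    then obtain J where r: "r \<in> carrier R" and J: "GV_ideal R J" and Jr: "\<And>j. j \<in> J \<Longrightarrow> j \<otimes> r \<otimes> a \<in> I"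
      by (auto elim: GV_closureE)
    have "r \<otimes> a \<in> GV_closure R (ring_as_module R) I"
      using Jr r a ideal.Icarr[OF GV_ideal_imp_ideal[OF J]]
      by (intro GV_closureI[OF _ J]) (simp_all add: m_assoc)
    then show "r \<in> {r \<in> carrier R. r \<otimes> a \<in> I}" using r cl by blast
  qed
qed

lemma (in cring) w_Max_not_GV:
  assumes m: "\<mm> \<in> w_Max R" and J: "GV_ideal R J"
  shows "\<not> J \<subseteq> \<mm>"
proof
  assume "J \<subseteq> \<mm>"
  then have "\<one> \<in> GV_closure R (ring_as_module R) \<mm>"
    using ideal.Icarr[OF GV_ideal_imp_ideal[OF J]] by (intro GV_closureI[OF _ J]) auto
  then show False using m ideal.one_imp_carrier[of \<mm> R] by (auto simp: w_Max_def w_ideal_iff)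
qed

text \<open>For \<open>b \<notin> \<mm>\<close> the colon ideal \<open>(\<mm> : b)\<close> is a proper \<open>w\<close>-ideal containing \<open>\<mm>\<close>, so it equals \<open>\<mm>\<close>.\<close>

lemma (in cring) w_Max_prime:
  assumes m: "\<mm> \<in> w_Max R"
  shows "primeideal \<mm> R"
proof (rule primeidealI)
  have w: "w_ideal R \<mm>" and proper: "\<mm> \<noteq> carrier R" using m by (auto simp: w_Max_def)
  show mi: "ideal \<mm> R" using w by (simp add: w_ideal_iff)
  show "cring R" by (rule is_cring)
  show "carrier R \<noteq> \<mm>" using proper by blast
  fix a b assume a: "a \<in> carrier R" and b: "b \<in> carrier R" and ab: "a \<otimes> b \<in> \<mm>"
  let ?C = "{r \<in> carrier R. r \<otimes> b \<in> \<mm>}"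
  show "a \<in> \<mm> \<or> b \<in> \<mm>"
  proof (cases "?C = carrier R")
    case True
    then have "\<one> \<otimes> b \<in> \<mm>" by blast
    then show ?thesis using b by simp
  next
    case False
    have "\<mm> \<subseteq> ?C" using ideal.I_r_closed[OF mi _ b] ideal.Icarr[OF mi] by blast
    then have "?C = \<mm>" using m w_ideal_colon[OF w b] False by (auto simp: w_Max_def)
    then show ?thesis using a ab by blast
  qed
qed

text \<open>The closure of \<open>I\<close> is a \<open>w\<close>-ideal, proper because \<open>1\<close> in it would mean \<open>J \<subseteq> I\<close> for a \<open>GV\<close>-ideal \<open>J\<close>. Zorn's
  lemma applies above it: \<open>GV\<close>-ideals are finitely generated, so a union of a chain of closed ideals is
  closed.\<close>

lemma (in cring) ex_w_Max:
  assumes I: "ideal I R" and noGV: "\<And>J. GV_ideal R J \<Longrightarrow> \<not> J \<subseteq> I"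
  shows "\<exists>\<mm>\<in>w_Max R. I \<subseteq> \<mm>"
proof -
  let ?R = "ring_as_module R"
  interpret RM: module R ?R by (rule ring_as_module_module)
  define A where "A = {P. w_ideal R P \<and> P \<noteq> carrier R \<and> I \<subseteq> P}"
  have Is: "submodule I R ?R" using I by (simp add: submodule_ring_as_module_iff)
  have one_iff: "P \<noteq> carrier R \<longleftrightarrow> \<one> \<notin> P" if "ideal P R" for P
    using ideal.one_imp_carrier[OF that] by auto
  have "GV_closure R ?R I \<in> A"
  proof -
    have id: "ideal (GV_closure R ?R I) R"
      using RM.GV_closure_submodule[OF Is] by (simp add: submodule_ring_as_module_iff)
    have "\<one> \<notin> GV_closure R ?R I"
    proof
      assume "\<one> \<in> GV_closure R ?R I"
      then obtain J where J: "GV_ideal R J" "\<And>a. a \<in> J \<Longrightarrow> a \<otimes> \<one> \<in> I" by (auto elim: GV_closureE)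
      then have "J \<subseteq> I" using ideal.Icarr[OF GV_ideal_imp_ideal[OF J(1)]] by fastforce
      then show False using noGV J(1) by blast
    qed
    then show ?thesis
      using id one_iff RM.GV_closure_idem[OF Is] RM.GV_closure_increasing[OF Is]
      by (simp add: A_def w_ideal_iff)
  qed
  then have "A \<noteq> {}" by blast
  moreover have "\<Union>\<C> \<in> A" if ne: "\<C> \<noteq> {}" and chain: "subset.chain A \<C>" for \<C>
  proof -
    have CA: "P \<in> A" if "P \<in> \<C>" for P using chain that by (auto simp: subset.chain_def)
    then have Pi: "ideal P R" and Pcl: "GV_closure R ?R P \<subseteq> P" and Pone: "\<one> \<notin> P" and IP: "I \<subseteq> P" if "P \<in> \<C>" for P
      using that one_iff by (auto simp: A_def w_ideal_iff)
    have chain': "subset.chain {N. submodule N R ?R} \<C>"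
      using chain Pi by (auto simp: subset.chain_def submodule_ring_as_module_iff)
    have U: "ideal (\<Union>\<C>) R"
      using RM.submodule_chain_Union[OF chain' ne] by (simp add: submodule_ring_as_module_iff)
    have "x \<in> \<Union>\<C>" if "x \<in> GV_closure R ?R (\<Union>\<C>)" for x
    proof -
      from that obtain J where x: "x \<in> carrier R" and J: "GV_ideal R J" and Jx: "\<And>a. a \<in> J \<Longrightarrow> a \<otimes> x \<in> \<Union>\<C>"
        by (auto elim: GV_closureE)
      obtain S where S: "finite S" "S \<subseteq> carrier R" "J = Idl S" using GV_ideal_fg[OF J] .
      have Sx: "finite ((\<lambda>s. s \<otimes> x) ` S)" "(\<lambda>s. s \<otimes> x) ` S \<subseteq> \<Union>\<C>"
        using S Jx genideal_self[OF S(2)] by blast+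
      obtain P where P: "P \<in> \<C>" "(\<lambda>s. s \<otimes> x) ` S \<subseteq> P"
        using finite_subset_Union_chain[OF Sx ne chain] .
      have "x \<in> GV_closure R ?R P"
        using x Idl_mult_mem[OF Pi[OF P(1)] x S(2)] P(2) S(3) by (intro GV_closureI[OF _ J]) auto
      then show ?thesis using Pcl P(1) by blast
    qed
    moreover have "\<one> \<notin> \<Union>\<C>" using Pone by blast
    moreover have "I \<subseteq> \<Union>\<C>" using IP ne by blast
    ultimately show ?thesis using U one_iff[OF U] by (auto simp: A_def w_ideal_iff)
  qed
  ultimately obtain \<mm> where m: "\<mm> \<in> A" "\<forall>X\<in>A. \<mm> \<subseteq> X \<longrightarrow> X = \<mm>"
    using subset_Zorn_nonempty[of A] by blast
  then have "\<mm> \<in> w_Max R" unfolding w_Max_def A_def by blast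
  then show ?thesis using m(1) by (auto simp: A_def)
qed

section \<open>\<open>w\<close>-epimorphisms and modules of \<open>w\<close>-finite type\<close>

lemma local_rel_refl:
  assumes "x \<in> carrier M" and "s \<in> carrier R - \<pp>"
  shows "((x, s), (x, s)) \<in> local_rel R M \<pp>"
  using assms by (auto simp: local_rel_def)

context module
begin

lemma local_rel_equiv:
  assumes p: "primeideal \<pp> R"
  shows "equiv (carrier M \<times> (carrier R - \<pp>)) (local_rel R M \<pp>)"
proof (rule equivI)
  interpret p: primeideal \<pp> R by fact
  show "local_rel R M \<pp> \<subseteq> (carrier M \<times> (carrier R - \<pp>)) \<times> (carrier M \<times> (carrier R - \<pp>))"
    by (auto simp: local_rel_def)
  show "refl_on (carrier M \<times> (carrier R - \<pp>)) (local_rel R M \<pp>)"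
    by (auto simp: refl_on_def intro: local_rel_refl)
  show "sym (local_rel R M \<pp>)"
    by (force simp: sym_def local_rel_def)
  show "trans (local_rel R M \<pp>)"
  proof (rule transI, clarsimp simp: local_rel_def)
    fix x s y t z r u v
    assume M: "x \<in> carrier M" "y \<in> carrier M" "z \<in> carrier M"
      and R: "s \<in> carrier R" "t \<in> carrier R" "r \<in> carrier R" "u \<in> carrier R" "v \<in> carrier R"
      and np: "s \<notin> \<pp>" "t \<notin> \<pp>" "r \<notin> \<pp>" "u \<notin> \<pp>" "v \<notin> \<pp>"
      and 1: "u \<odot>\<^bsub>M\<^esub> (t \<odot>\<^bsub>M\<^esub> x) = u \<odot>\<^bsub>M\<^esub> (s \<odot>\<^bsub>M\<^esub> y)"
      and 2: "v \<odot>\<^bsub>M\<^esub> (r \<odot>\<^bsub>M\<^esub> y) = v \<odot>\<^bsub>M\<^esub> (t \<odot>\<^bsub>M\<^esub> z)"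
    let ?w = "t \<otimes> (u \<otimes> v)"
    have "?w \<in> carrier R - \<pp>" using R np p.I_prime by (metis DiffI R.m_closed)
    moreover have "?w \<odot>\<^bsub>M\<^esub> (r \<odot>\<^bsub>M\<^esub> x) = ?w \<odot>\<^bsub>M\<^esub> (s \<odot>\<^bsub>M\<^esub> z)"
    proof -
      have "?w \<odot>\<^bsub>M\<^esub> (r \<odot>\<^bsub>M\<^esub> x) = (t \<otimes> (u \<otimes> v) \<otimes> r) \<odot>\<^bsub>M\<^esub> x"
        using M R by (simp add: smult_assoc1)
      also have "t \<otimes> (u \<otimes> v) \<otimes> r = (v \<otimes> r) \<otimes> (u \<otimes> t)" using R by (simp add: R.m_ac)
      also have "\<dots> \<odot>\<^bsub>M\<^esub> x = (v \<otimes> r) \<odot>\<^bsub>M\<^esub> (u \<odot>\<^bsub>M\<^esub> (s \<odot>\<^bsub>M\<^esub> y))"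
        using M R 1 by (simp add: smult_assoc1)
      also have "\<dots> = ((v \<otimes> r) \<otimes> (u \<otimes> s)) \<odot>\<^bsub>M\<^esub> y" using M R by (simp add: smult_assoc1)
      also have "(v \<otimes> r) \<otimes> (u \<otimes> s) = (u \<otimes> s) \<otimes> (v \<otimes> r)" using R by (simp add: R.m_ac)
      also have "\<dots> \<odot>\<^bsub>M\<^esub> y = (u \<otimes> s) \<odot>\<^bsub>M\<^esub> (v \<odot>\<^bsub>M\<^esub> (t \<odot>\<^bsub>M\<^esub> z))"
        using M R 2 by (simp add: smult_assoc1)
      also have "\<dots> = ((u \<otimes> s) \<otimes> (v \<otimes> t)) \<odot>\<^bsub>M\<^esub> z" using M R by (simp add: smult_assoc1)
      also have "(u \<otimes> s) \<otimes> (v \<otimes> t) = ?w \<otimes> s" using R by (simp add: R.m_ac)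
      also have "\<dots> \<odot>\<^bsub>M\<^esub> z = ?w \<odot>\<^bsub>M\<^esub> (s \<odot>\<^bsub>M\<^esub> z)" using M R by (simp add: smult_assoc1)
      finally show ?thesis .
    qed
    ultimately show "\<exists>w\<in>carrier R - \<pp>. w \<odot>\<^bsub>M\<^esub> (r \<odot>\<^bsub>M\<^esub> x) = w \<odot>\<^bsub>M\<^esub> (s \<odot>\<^bsub>M\<^esub> z)" by blast
  qed
qed

end

lemma local_map_class:
  assumes F: "module R F" and M: "module R M" and f: "linear_map R F M f" and p: "primeideal \<pp> R"
    and c: "c \<in> carrier F" and s: "s \<in> carrier R - \<pp>"
  shows "local_map R M \<pp> f (local_rel R F \<pp> `` {(c, s)}) = local_rel R M \<pp> `` {(f c, s)}"
proof -
  interpret F: module R F by fact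
  interpret M: module R M by fact
  note fD = linear_mapD[OF f]
  have "local_rel R M \<pp> `` {(f c', s')} = local_rel R M \<pp> `` {(f c, s)}"
    if "((c, s), (c', s')) \<in> local_rel R F \<pp>" for c' s'
  proof -
    from that obtain u where c': "c' \<in> carrier F" and s': "s' \<in> carrier R - \<pp>" and u: "u \<in> carrier R - \<pp>"
      and eq: "u \<odot>\<^bsub>F\<^esub> (s' \<odot>\<^bsub>F\<^esub> c) = u \<odot>\<^bsub>F\<^esub> (s \<odot>\<^bsub>F\<^esub> c')"
      by (auto simp: local_rel_def)
    have "u \<odot>\<^bsub>M\<^esub> (s' \<odot>\<^bsub>M\<^esub> f c) = u \<odot>\<^bsub>M\<^esub> (s \<odot>\<^bsub>M\<^esub> f c')"
      using arg_cong[OF eq, of f] c c' s s' u by (simp add: fD(3))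
    then have "((f c, s), (f c', s')) \<in> local_rel R M \<pp>"
      using fD(1) c c' s s' u by (auto simp: local_rel_def)
    then show ?thesis using equiv_class_eq[OF M.local_rel_equiv[OF p]] by metis
  qed
  moreover have "(c, s) \<in> local_rel R F \<pp> `` {(c, s)}" using local_rel_refl[OF c s] by simp
  ultimately show ?thesis unfolding local_map_def by blast
qed

text \<open>The class of \<open>(x, 1)\<close> is hit iff \<open>u s x = u f c = f (u c)\<close> for some \<open>c\<close> and some \<open>u\<close>, \<open>s\<close> outside \<open>\<pp>\<close>.\<close>

lemma local_map_surj_iff:
  assumes F: "module R F" and M: "module R M" and f: "linear_map R F M f" and p: "primeideal \<pp> R"
  shows "local_map R M \<pp> f ` localization R F \<pp> = localization R M \<pp> \<longleftrightarrow>
    (\<forall>x\<in>carrier M. \<exists>s\<in>carrier R - \<pp>. s \<odot>\<^bsub>M\<^esub> x \<in> f ` carrier F)"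
proof -
  interpret F: module R F by fact
  interpret M: module R M by fact
  interpret p: primeideal \<pp> R by fact
  note fD = linear_mapD[OF f]
  note cls = local_map_class[OF F M f p]
  have one: "\<one>\<^bsub>R\<^esub> \<in> carrier R - \<pp>" using p.I_notcarr p.one_imp_carrier by auto
  have mult: "s \<otimes>\<^bsub>R\<^esub> t \<in> carrier R - \<pp>" if "s \<in> carrier R - \<pp>" "t \<in> carrier R - \<pp>" for s t
    using that p.I_prime by auto
  have locI: "local_rel R M \<pp> `` {(x, s)} \<in> localization R M \<pp>" if "x \<in> carrier M" "s \<in> carrier R - \<pp>" for x s
    unfolding localization_def using that by (intro quotientI) auto
  show ?thesis
  proof
    assume surj: "local_map R M \<pp> f ` localization R F \<pp> = localization R M \<pp>"
    show "\<forall>x\<in>carrier M. \<exists>s\<in>carrier R - \<pp>. s \<odot>\<^bsub>M\<^esub> x \<in> f ` carrier F"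
    proof
      fix x assume x: "x \<in> carrier M"
      have "local_rel R M \<pp> `` {(x, \<one>\<^bsub>R\<^esub>)} \<in> local_map R M \<pp> f ` localization R F \<pp>"
        using locI[OF x one] surj by simp
      then obtain X where "X \<in> localization R F \<pp>"
        and X: "local_rel R M \<pp> `` {(x, \<one>\<^bsub>R\<^esub>)} = local_map R M \<pp> f X" by blast
      then obtain c s where c: "c \<in> carrier F" and s: "s \<in> carrier R - \<pp>"
        and "X = local_rel R F \<pp> `` {(c, s)}"
        unfolding localization_def by (auto elim!: quotientE)
      with X cls[OF c s] have "local_rel R M \<pp> `` {(x, \<one>\<^bsub>R\<^esub>)} = local_rel R M \<pp> `` {(f c, s)}" by simp
      moreover have "((f c, s), (f c, s)) \<in> local_rel R M \<pp>" by (rule local_rel_refl[OF fD(1)[OF c] s])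
      ultimately have "((x, \<one>\<^bsub>R\<^esub>), (f c, s)) \<in> local_rel R M \<pp>" by (metis Image_singleton_iff)
      then obtain u where u: "u \<in> carrier R - \<pp>"
        and eq: "u \<odot>\<^bsub>M\<^esub> (s \<odot>\<^bsub>M\<^esub> x) = u \<odot>\<^bsub>M\<^esub> (\<one>\<^bsub>R\<^esub> \<odot>\<^bsub>M\<^esub> f c)"
        by (auto simp: local_rel_def)
      have "(u \<otimes>\<^bsub>R\<^esub> s) \<odot>\<^bsub>M\<^esub> x = f (u \<odot>\<^bsub>F\<^esub> c)"
        using eq u s x c by (simp add: M.smult_assoc1 fD)
      then show "\<exists>s\<in>carrier R - \<pp>. s \<odot>\<^bsub>M\<^esub> x \<in> f ` carrier F"
        using mult[OF u s] c u by (intro bexI[of _ "u \<otimes>\<^bsub>R\<^esub> s"]) auto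
    qed
  next
    assume surj: "\<forall>x\<in>carrier M. \<exists>s\<in>carrier R - \<pp>. s \<odot>\<^bsub>M\<^esub> x \<in> f ` carrier F"
    show "local_map R M \<pp> f ` localization R F \<pp> = localization R M \<pp>"
    proof
      show "local_map R M \<pp> f ` localization R F \<pp> \<subseteq> localization R M \<pp>"
      proof clarify
        fix X assume "X \<in> localization R F \<pp>"
        then obtain c s where c: "c \<in> carrier F" and s: "s \<in> carrier R - \<pp>"
          and "X = local_rel R F \<pp> `` {(c, s)}"
          unfolding localization_def by (auto elim!: quotientE)
        then show "local_map R M \<pp> f X \<in> localization R M \<pp>"
          using cls[OF c s] locI[OF fD(1)[OF c] s] by simp
      qed
      show "localization R M \<pp> \<subseteq> local_map R M \<pp> f ` localization R F \<pp>"
      proof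
        fix Y assume "Y \<in> localization R M \<pp>"
        then obtain x t where x: "x \<in> carrier M" and t: "t \<in> carrier R - \<pp>"
          and Y: "Y = local_rel R M \<pp> `` {(x, t)}"
          unfolding localization_def by (auto elim!: quotientE)
        obtain s c where s: "s \<in> carrier R - \<pp>" and c: "c \<in> carrier F" and sx: "s \<odot>\<^bsub>M\<^esub> x = f c"
          using surj x by blast
        have "((x, t), (f c, s \<otimes>\<^bsub>R\<^esub> t)) \<in> local_rel R M \<pp>"
        proof -
          have "(s \<otimes>\<^bsub>R\<^esub> t) \<odot>\<^bsub>M\<^esub> x = t \<odot>\<^bsub>M\<^esub> f c"
            using s t x by (simp add: F.R.m_comm[of s t] M.smult_assoc1 flip: sx)
          then show ?thesis
            using x t fD(1)[OF c] mult[OF s t] one by (auto simp: local_rel_def)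
        qed
        then have "Y = local_rel R M \<pp> `` {(f c, s \<otimes>\<^bsub>R\<^esub> t)}"
          unfolding Y by (rule equiv_class_eq[OF M.local_rel_equiv[OF p]])
        also have "\<dots> = local_map R M \<pp> f (local_rel R F \<pp> `` {(c, s \<otimes>\<^bsub>R\<^esub> t)})"
          using cls[OF c mult[OF s t]] by simp
        finally show "Y \<in> local_map R M \<pp> f ` localization R F \<pp>"
          using c mult[OF s t] unfolding localization_def by (auto intro!: quotientI)
      qed
    qed
  qed
qed

text \<open>The ideal \<open>(f(F) : x)\<close> lies in no maximal \<open>w\<close>-ideal iff it contains a \<open>GV\<close>-ideal.\<close>

lemma w_epi_iff:
  assumes F: "module R F" and M: "module R M"
  shows "w_epi R F M f \<longleftrightarrow>
    f \<in> carrier (Hom_module R F M) \<and> carrier M \<subseteq> GV_closure R M (f ` carrier F)"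
proof (cases "f \<in> carrier (Hom_module R F M)")
  case False
  then show ?thesis by (simp add: w_epi_def)
next
  case True
  then have f: "linear_map R F M f" by (simp add: Hom_module_iff)
  interpret F: module R F by fact
  interpret M: module R M by fact
  have im: "submodule (f ` carrier F) R M"
    by (rule submodule_image[OF F M f F.carrier_is_submodule])
  have "w_epi R F M f \<longleftrightarrow>
      (\<forall>\<mm>\<in>w_Max R. \<forall>x\<in>carrier M. \<exists>s\<in>carrier R - \<mm>. s \<odot>\<^bsub>M\<^esub> x \<in> f ` carrier F)"
    using True local_map_surj_iff[OF F M f F.R.w_Max_prime] by (simp add: w_epi_def)
  also have "\<dots> \<longleftrightarrow> carrier M \<subseteq> GV_closure R M (f ` carrier F)"
  proof
    assume loc: "\<forall>\<mm>\<in>w_Max R. \<forall>x\<in>carrier M. \<exists>s\<in>carrier R - \<mm>. s \<odot>\<^bsub>M\<^esub> x \<in> f ` carrier F"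
    show "carrier M \<subseteq> GV_closure R M (f ` carrier F)"
    proof
      fix x assume x: "x \<in> carrier M"
      let ?I = "{r \<in> carrier R. r \<odot>\<^bsub>M\<^esub> x \<in> f ` carrier F}"
      have "\<not> ?I \<subseteq> \<mm>" if "\<mm> \<in> w_Max R" for \<mm> using loc that x by blast
      then obtain J where J: "GV_ideal R J" "J \<subseteq> ?I"
        using F.R.ex_w_Max[OF M.colon_ideal[OF im x]] by blast
      then show "x \<in> GV_closure R M (f ` carrier F)" by (intro GV_closureI[OF x J(1)]) blast
    qed
  next
    assume cl: "carrier M \<subseteq> GV_closure R M (f ` carrier F)"
    show "\<forall>\<mm>\<in>w_Max R. \<forall>x\<in>carrier M. \<exists>s\<in>carrier R - \<mm>. s \<odot>\<^bsub>M\<^esub> x \<in> f ` carrier F"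
    proof (intro ballI)
      fix \<mm> x assume m: "\<mm> \<in> w_Max R" and "x \<in> carrier M"
      then have "x \<in> GV_closure R M (f ` carrier F)" using cl by blast
      then obtain J where J: "GV_ideal R J" and Jx: "\<And>a. a \<in> J \<Longrightarrow> a \<odot>\<^bsub>M\<^esub> x \<in> f ` carrier F"
        by (rule GV_closureE) blast
      obtain a where "a \<in> J" "a \<notin> \<mm>" using F.R.w_Max_not_GV[OF m J] by blast
      then show "\<exists>s\<in>carrier R - \<mm>. s \<odot>\<^bsub>M\<^esub> x \<in> f ` carrier F"
        using Jx ideal.Icarr[OF F.R.GV_ideal_imp_ideal[OF J]] by blast
    qed
  qed
  finally show ?thesis using True by simp
qed

text \<open>An intersection, so that minimality replaces computations with linear combinations.\<close>

definition module_span :: "('a, 'b) ring_scheme \<Rightarrow> ('a, 'm, 'c) module_scheme \<Rightarrow> 'm set \<Rightarrow> 'm set" where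
  "module_span R M S = \<Inter>{N. submodule N R M \<and> S \<subseteq> N}"

text \<open>This expresses that \<open>N\<close> is of \<open>w\<close>-finite type, but the span and the closure are taken in the fixed module
  \<open>M\<close>, so that different submodules can be compared.\<close>

definition w_fg :: "('a, 'b) ring_scheme \<Rightarrow> ('a, 'm, 'c) module_scheme \<Rightarrow> 'm set \<Rightarrow> bool" where
  "w_fg R M N \<longleftrightarrow> (\<exists>S. finite S \<and> S \<subseteq> N \<and> N \<subseteq> GV_closure R M (module_span R M S))"

lemma w_fgI:
  "finite S \<Longrightarrow> S \<subseteq> N \<Longrightarrow> N \<subseteq> GV_closure R M (module_span R M S) \<Longrightarrow> w_fg R M N"
  by (auto simp: w_fg_def)

lemma w_fgE:
  assumes "w_fg R M N"
  obtains S where "finite S" "S \<subseteq> N" "N \<subseteq> GV_closure R M (module_span R M S)"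
  using assms by (auto simp: w_fg_def)

lemma module_span_superset: "S \<subseteq> module_span R M S"
  by (auto simp: module_span_def)

lemma module_span_minimal: "submodule N R M \<Longrightarrow> S \<subseteq> N \<Longrightarrow> module_span R M S \<subseteq> N"
  by (auto simp: module_span_def)

lemma module_span_mono: "S \<subseteq> T \<Longrightarrow> module_span R M S \<subseteq> module_span R M T"
  by (auto simp: module_span_def)

lemma (in module) module_span_submodule:
  "S \<subseteq> carrier M \<Longrightarrow> submodule (module_span R M S) R M"
  unfolding module_span_def
  by (rule submodule_Inter) (use carrier_is_submodule in auto)

lemma GV_closure_restrict_carrier:
  "N \<subseteq> carrier M \<Longrightarrow> GV_closure R (M\<lparr>carrier := N\<rparr>) T = N \<inter> GV_closure R M T"
  by (auto simp: GV_closure_def)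

lemma (in module) w_finite_type_iff:
  assumes N: "submodule N R M"
  shows "w_finite_type R (M\<lparr>carrier := N\<rparr>) \<longleftrightarrow> w_fg R M N"
proof
  let ?N = "M\<lparr>carrier := N\<rparr>"
  have NM: "module R ?N" by (rule submodule.submodule_is_module[OF N module_axioms])
  interpret NM: module R ?N by (rule NM)
  have NsubM: "N \<subseteq> carrier M" by (rule submoduleE(1)[OF N])
  have F: "module R (free_module R X)" for X :: "nat set" by (rule R.free_module_module)
  {
    assume "w_finite_type R ?N"
    then obtain n :: nat and f where "w_epi R (free_module R {..<n}) ?N f" by (auto simp: w_finite_type_def)
    then have f: "linear_map R (free_module R {..<n}) ?N f"
      and cl: "N \<subseteq> GV_closure R ?N (f ` carrier (free_module R {..<n}))"
      unfolding w_epi_iff[OF F NM] by (simp_all add: Hom_module_iff)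
    let ?F = "free_module R {..<n}"
    have fM: "linear_map R ?F M f"
      using linear_mapD[OF f] NsubM by (intro linear_mapI) auto
    let ?S = "(\<lambda>i. f (unit_vector R {..<n} i)) ` {..<n}"
    have SN: "?S \<subseteq> N" using linear_mapD(1)[OF f] R.unit_vector_closed by fastforce
    have span: "submodule (module_span R M ?S) R M" by (rule module_span_submodule) (use SN NsubM in blast)
    have "{c \<in> carrier ?F. f c \<in> module_span R M ?S} = carrier ?F"
      by (rule R.free_module_generated[OF submodule_vimage[OF F module_axioms fM span]])
         (simp add: R.unit_vector_closed subsetD[OF module_span_superset])
    then have "f ` carrier ?F \<subseteq> module_span R M ?S" by blast
    then have "N \<subseteq> GV_closure R M (module_span R M ?S)"
      using cl GV_closure_mono[of _ "module_span R M ?S" R M]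
      unfolding GV_closure_restrict_carrier[OF NsubM] by blast
    then show "w_fg R M N" by (intro w_fgI[OF _ SN]) auto
  }
  assume "w_fg R M N"
  then obtain S where S: "finite S" "S \<subseteq> N" and cl: "N \<subseteq> GV_closure R M (module_span R M S)" by (rule w_fgE)
  obtain h where h: "bij_betw h {0..<card S} S" using ex_bij_betw_nat_finite[OF S(1)] by blast
  define n where "n = card S"
  have hS: "h ` {..<n} = S" using h by (simp add: bij_betw_def n_def lessThan_atLeast0)
  then have hN: "h \<in> {..<n} \<rightarrow> carrier ?N" using S(2) by auto
  let ?F = "free_module R {..<n}"
  define f where "f = linear_extension R {..<n} ?N h"
  have f: "linear_map R ?F ?N f" unfolding f_def by (rule NM.linear_extension_linear[OF hN])
  have fM: "linear_map R ?F M f"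
    using linear_mapD[OF f] NsubM by (intro linear_mapI) auto
  interpret F: module R ?F by (rule F)
  have "h i \<in> f ` carrier ?F" if "i < n" for i
    using NM.linear_extension_unit_vector[OF hN, of i] that R.unit_vector_closed[of "{..<n}" i]
    unfolding f_def by (metis image_eqI lessThan_iff)
  then have "S \<subseteq> f ` carrier ?F" using hS by auto
  then have "module_span R M S \<subseteq> f ` carrier ?F"
    by (rule module_span_minimal[OF submodule_image[OF F module_axioms fM F.carrier_is_submodule]])
  then have "N \<subseteq> GV_closure R ?N (f ` carrier ?F)" 
    using cl GV_closure_mono[of "module_span R M S" "f ` carrier ?F" R M]
    unfolding GV_closure_restrict_carrier[OF NsubM] by blast
  then have "w_epi R ?F ?N (restrict f (carrier ?F))"
    unfolding w_epi_iff[OF F NM] using restrict_in_Hom_module[OF F f] by simp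
  then show "w_finite_type R ?N" by (auto simp: w_finite_type_def)
qed

section \<open>Submodules maximal among those not of \<open>w\<close>-finite type\<close>

context module
begin

lemma cyclic_submodule:
  assumes "x \<in> carrier M"
  shows "submodule ((\<lambda>r. r \<odot>\<^bsub>M\<^esub> x) ` carrier R) R M"
  using submodule_image[OF R.ring_as_module_module module_axioms smult_right_linear[OF assms]
      module.carrier_is_submodule[OF R.ring_as_module_module]] by simp

lemma mem_cyclic_submodule: "x \<in> carrier M \<Longrightarrow> x \<in> (\<lambda>r. r \<odot>\<^bsub>M\<^esub> x) ` carrier R"
  by (rule image_eqI[of _ _ \<one>]) auto

lemma set_add_memI: "x \<in> N \<Longrightarrow> y \<in> L \<Longrightarrow> x \<oplus>\<^bsub>M\<^esub> y \<in> N <+>\<^bsub>M\<^esub> L"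
  by (auto simp: set_add_def')

lemma set_add_submodule:
  assumes N: "submodule N R M" and L: "submodule L R M"
  shows "submodule (N <+>\<^bsub>M\<^esub> L) R M"
proof (rule submoduleI')
  note N' = submoduleE[OF N] and L' = submoduleE[OF L]
  have NM: "x \<in> carrier M" if "x \<in> N" for x using N'(1) that by blast
  have LM: "x \<in> carrier M" if "x \<in> L" for x using L'(1) that by blast
  show "N <+>\<^bsub>M\<^esub> L \<subseteq> carrier M" using NM LM by (auto simp: set_add_def')
  show "\<zero>\<^bsub>M\<^esub> \<in> N <+>\<^bsub>M\<^esub> L"
    using set_add_memI[OF submodule_zero[OF N] submodule_zero[OF L]] by simp
  fix x y assume "x \<in> N <+>\<^bsub>M\<^esub> L" and "y \<in> N <+>\<^bsub>M\<^esub> L"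
  then obtain n l n' l' where x: "x = n \<oplus>\<^bsub>M\<^esub> l" "n \<in> N" "l \<in> L" and y: "y = n' \<oplus>\<^bsub>M\<^esub> l'" "n' \<in> N" "l' \<in> L"
    by (auto simp: set_add_def')
  have "x \<oplus>\<^bsub>M\<^esub> y = (n \<oplus>\<^bsub>M\<^esub> n') \<oplus>\<^bsub>M\<^esub> (l \<oplus>\<^bsub>M\<^esub> l')"
    using x y NM LM by (simp add: M.a_ac)
  moreover have "n \<oplus>\<^bsub>M\<^esub> n' \<in> N" "l \<oplus>\<^bsub>M\<^esub> l' \<in> L" using x y N'(5) L'(5) by auto
  ultimately show "x \<oplus>\<^bsub>M\<^esub> y \<in> N <+>\<^bsub>M\<^esub> L" by (auto simp: set_add_def')
next
  note N' = submoduleE[OF N] and L' = submoduleE[OF L]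
  fix a x assume a: "a \<in> carrier R" and "x \<in> N <+>\<^bsub>M\<^esub> L"
  then obtain n l where x: "x = n \<oplus>\<^bsub>M\<^esub> l" "n \<in> N" "l \<in> L" by (auto simp: set_add_def')
  have "a \<odot>\<^bsub>M\<^esub> x = a \<odot>\<^bsub>M\<^esub> n \<oplus>\<^bsub>M\<^esub> a \<odot>\<^bsub>M\<^esub> l"
    using x a subsetD[OF N'(1)] subsetD[OF L'(1)] by (simp add: smult_r_distr)
  moreover have "a \<odot>\<^bsub>M\<^esub> n \<in> N" "a \<odot>\<^bsub>M\<^esub> l \<in> L" using x a N'(4) L'(4) by auto
  ultimately show "a \<odot>\<^bsub>M\<^esub> x \<in> N <+>\<^bsub>M\<^esub> L" by (auto simp: set_add_def')
qed

lemma set_add_upper: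
  assumes N: "submodule N R M" and L: "submodule L R M"
  shows "N \<subseteq> N <+>\<^bsub>M\<^esub> L" and "L \<subseteq> N <+>\<^bsub>M\<^esub> L"
proof -
  show "N \<subseteq> N <+>\<^bsub>M\<^esub> L"
    using set_add_memI[OF _ submodule_zero[OF L], of _ N] submoduleE(1)[OF N] by force
  show "L \<subseteq> N <+>\<^bsub>M\<^esub> L"
    using set_add_memI[OF submodule_zero[OF N], of _ L] submoduleE(1)[OF L] by force
qed

text \<open>Write each generator \<open>s\<close> of \<open>N + L\<close> as \<open>\<nu> s + l\<close>. For \<open>x \<in> N\<close>, a \<open>GV\<close>-ideal carries \<open>x\<close> into
  \<open>\<langle>\<nu> ` S\<rangle> + L\<close>, and the component in \<open>L\<close> is a difference of elements of \<open>N\<close>. So it lies in \<open>N \<inter> L\<close>, which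
  is covered by \<open>T\<close>.\<close>

lemma w_fg_of_sum_and_inter:
  assumes N: "submodule N R M" and L: "submodule L R M"
    and sum: "w_fg R M (N <+>\<^bsub>M\<^esub> L)"
    and T: "finite T" "T \<subseteq> N" and inter: "N \<inter> L \<subseteq> GV_closure R M (module_span R M T)"
  shows "w_fg R M N"
proof -
  obtain S where S: "finite S" "S \<subseteq> N <+>\<^bsub>M\<^esub> L" "N <+>\<^bsub>M\<^esub> L \<subseteq> GV_closure R M (module_span R M S)"
    using sum by (rule w_fgE)
  have "\<exists>n. n \<in> N \<and> (\<exists>l\<in>L. s = n \<oplus>\<^bsub>M\<^esub> l)" if "s \<in> S" for s
    using subsetD[OF S(2) that] by (auto simp: set_add_def')
  then obtain \<nu> where \<nu>: "\<And>s. s \<in> S \<Longrightarrow> \<nu> s \<in> N" "\<And>s. s \<in> S \<Longrightarrow> \<exists>l\<in>L. s = \<nu> s \<oplus>\<^bsub>M\<^esub> l" by metis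
  let ?U = "\<nu> ` S \<union> T"
  have UN: "?U \<subseteq> N" using \<nu>(1) T(2) by auto
  have NM: "N \<subseteq> carrier M" and LM: "L \<subseteq> carrier M" using submoduleE(1) N L by auto
  have sp\<nu>: "submodule (module_span R M (\<nu> ` S)) R M"
    by (rule module_span_submodule) (use UN NM in blast)
  have spU: "submodule (module_span R M ?U) R M"
    by (rule module_span_submodule) (use UN NM in blast)
  note clU = submoduleE[OF GV_closure_submodule[OF spU]]
  have "s \<in> module_span R M (\<nu> ` S) <+>\<^bsub>M\<^esub> L" if s: "s \<in> S" for s
  proof -
    have "\<nu> s \<in> module_span R M (\<nu> ` S)" using subsetD[OF module_span_superset imageI[OF s]] .
    then show ?thesis using \<nu>(2)[OF s] set_add_memI by metis
  qed
  then have spS: "module_span R M S \<subseteq> module_span R M (\<nu> ` S) <+>\<^bsub>M\<^esub> L"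
    by (intro module_span_minimal[OF set_add_submodule[OF sp\<nu> L]]) blast
  have "N \<subseteq> GV_closure R M (GV_closure R M (module_span R M ?U))"
  proof
    fix x assume x: "x \<in> N"
    then have "x \<in> GV_closure R M (module_span R M S)" using set_add_upper(1)[OF N L] S(3) by blast
    then obtain J where J: "GV_ideal R J" and Jx: "\<And>j. j \<in> J \<Longrightarrow> j \<odot>\<^bsub>M\<^esub> x \<in> module_span R M S"
      by (rule GV_closureE) blast
    have "j \<odot>\<^bsub>M\<^esub> x \<in> GV_closure R M (module_span R M ?U)" if j: "j \<in> J" for j
    proof -
      have "j \<odot>\<^bsub>M\<^esub> x \<in> module_span R M (\<nu> ` S) <+>\<^bsub>M\<^esub> L" using Jx[OF j] spS by blast
      then obtain n l where n: "n \<in> module_span R M (\<nu> ` S)" and l: "l \<in> L" and eq: "j \<odot>\<^bsub>M\<^esub> x = n \<oplus>\<^bsub>M\<^esub> l"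
        by (auto simp: set_add_def')
      have nN: "n \<in> N" using module_span_minimal[OF N, of "\<nu> ` S"] n \<nu>(1) by blast
      have jx: "j \<odot>\<^bsub>M\<^esub> x \<in> N"
        using submoduleE(4)[OF N] x ideal.Icarr[OF R.GV_ideal_imp_ideal[OF J] j] by blast
      have "l = (n \<oplus>\<^bsub>M\<^esub> l) \<ominus>\<^bsub>M\<^esub> n"
        using nN l NM LM by (simp add: subset_iff a_minus_def M.a_ac M.r_neg)
      then have "l \<in> N" using submodule_minus[OF N jx nN] eq by simp
      then have "l \<in> GV_closure R M (module_span R M T)" using l inter by blast
      then have l': "l \<in> GV_closure R M (module_span R M ?U)"
        using GV_closure_mono[OF module_span_mono[of T ?U R M]] by blast
      have "n \<in> GV_closure R M (module_span R M ?U)"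
        using n module_span_mono[of "\<nu> ` S" ?U R M] GV_closure_increasing[OF spU] by blast
      then show ?thesis using l' clU(5) eq by simp
    qed
    then show "x \<in> GV_closure R M (GV_closure R M (module_span R M ?U))"
      using x NM by (blast intro: GV_closureI[OF _ J])
  qed
  then have "N \<subseteq> GV_closure R M (module_span R M ?U)" using GV_closure_idem[OF spU] by blast
  then show ?thesis using S(1) T(1) UN by (intro w_fgI[of ?U]) auto
qed

definition maximal_non_w_fg :: "'c set \<Rightarrow> bool" where
  "maximal_non_w_fg N \<longleftrightarrow> submodule N R M \<and> \<not> w_fg R M N \<and>
     (\<forall>N'. submodule N' R M \<and> N \<subset> N' \<longrightarrow> w_fg R M N')"

text \<open>If the union of a chain were of \<open>w\<close>-finite type, its finite generating set would lie in one member of the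
  chain, and up to closure it would generate that member too.\<close>

lemma ex_maximal_non_w_fg:
  assumes N: "submodule N R M" and "\<not> w_fg R M N"
  shows "\<exists>N. maximal_non_w_fg N"
proof -
  define A where "A = {N. submodule N R M \<and> \<not> w_fg R M N}"
  have "A \<noteq> {}" using assms by (auto simp: A_def)
  moreover have "\<Union>\<C> \<in> A" if ne: "\<C> \<noteq> {}" and chain: "subset.chain A \<C>" for \<C>
  proof -
    have CA: "P \<in> A" if "P \<in> \<C>" for P using chain that by (auto simp: subset.chain_def)
    have chain': "subset.chain {N. submodule N R M} \<C>"
      using chain by (auto simp: subset.chain_def A_def)
    have "\<not> w_fg R M (\<Union>\<C>)"
    proof
      assume "w_fg R M (\<Union>\<C>)"
      then obtain S where S: "finite S" "S \<subseteq> \<Union>\<C>" "\<Union>\<C> \<subseteq> GV_closure R M (module_span R M S)" by (rule w_fgE)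
      obtain P where P: "P \<in> \<C>" "S \<subseteq> P" using finite_subset_Union_chain[OF S(1,2) ne chain] .
      then have "P \<subseteq> GV_closure R M (module_span R M S)" using S(3) by blast
      then have "w_fg R M P" using S(1) P(2) by (intro w_fgI)
      then show False using CA[OF P(1)] by (simp add: A_def)
    qed
    then show ?thesis using submodule_chain_Union[OF chain' ne] by (simp add: A_def)
  qed
  ultimately obtain N where "N \<in> A" "\<forall>X\<in>A. N \<subseteq> X \<longrightarrow> X = N"
    using subset_Zorn_nonempty[of A] by blast
  then show ?thesis unfolding maximal_non_w_fg_def A_def by blast
qed

context
  fixes N assumes max: "maximal_non_w_fg N"
begin

lemma maximal_submodule: "submodule N R M"
  using max by (simp add: maximal_non_w_fg_def)

lemma maximal_absorbs:
  assumes L: "submodule L R M" and T: "finite T" "T \<subseteq> N"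
    and inter: "N \<inter> L \<subseteq> GV_closure R M (module_span R M T)"
  shows "L \<subseteq> N"
proof (rule ccontr)
  assume "\<not> L \<subseteq> N"
  then have "N \<subset> N <+>\<^bsub>M\<^esub> L" using set_add_upper[OF maximal_submodule L] by blast
  then have "w_fg R M (N <+>\<^bsub>M\<^esub> L)"
    using max set_add_submodule[OF maximal_submodule L] by (simp add: maximal_non_w_fg_def)
  then have "w_fg R M N" by (rule w_fg_of_sum_and_inter[OF maximal_submodule L _ T inter])
  then show False using max by (simp add: maximal_non_w_fg_def)
qed

text \<open>For \<open>J x \<subseteq> N\<close> with \<open>J\<close> generated by a finite set \<open>S\<close>, the elements \<open>s x\<close> with \<open>s \<in> S\<close> generate \<open>J x\<close>, whose closure
  contains \<open>R x\<close>.\<close>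

lemma maximal_GV_closed: "GV_closure R M N \<subseteq> N"
proof
  note Ns = maximal_submodule
  fix x assume "x \<in> GV_closure R M N"
  then obtain J where x: "x \<in> carrier M" and J: "GV_ideal R J" and Jx: "\<And>j. j \<in> J \<Longrightarrow> j \<odot>\<^bsub>M\<^esub> x \<in> N"
    by (rule GV_closureE) blast
  obtain S where S: "finite S" "S \<subseteq> carrier R" "J = Idl S" using R.GV_ideal_fg[OF J] .
  let ?T = "(\<lambda>s. s \<odot>\<^bsub>M\<^esub> x) ` S"
  have TN: "?T \<subseteq> N" using Jx R.genideal_self[OF S(2)] S(3) by blast
  have spT: "submodule (module_span R M ?T) R M"
    by (rule module_span_submodule) (use TN submoduleE(1)[OF Ns] in blast)
  have Jspan: "j \<odot>\<^bsub>M\<^esub> x \<in> module_span R M ?T" if "j \<in> J" for j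
    by (rule Idl_smult_mem[OF spT x S(2)]) (use that S(3) module_span_superset[of ?T] in auto)
  have "(\<lambda>r. r \<odot>\<^bsub>M\<^esub> x) ` carrier R \<subseteq> N"
  proof (rule maximal_absorbs[OF cyclic_submodule[OF x] _ TN])
    show "finite ?T" using S(1) by simp
    show "N \<inter> (\<lambda>r. r \<odot>\<^bsub>M\<^esub> x) ` carrier R \<subseteq> GV_closure R M (module_span R M ?T)"
    proof clarify
      fix r assume r: "r \<in> carrier R"
      show "r \<odot>\<^bsub>M\<^esub> x \<in> GV_closure R M (module_span R M ?T)"
      proof (rule GV_closureI[OF _ J])
        show "r \<odot>\<^bsub>M\<^esub> x \<in> carrier M" using r x by simp
        fix j assume j: "j \<in> J"
        have "j \<in> carrier R" using ideal.Icarr[OF R.GV_ideal_imp_ideal[OF J] j] .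
        then have "j \<odot>\<^bsub>M\<^esub> (r \<odot>\<^bsub>M\<^esub> x) = r \<odot>\<^bsub>M\<^esub> (j \<odot>\<^bsub>M\<^esub> x)" using r x by (metis smult_assoc1 R.m_comm)
        then show "j \<odot>\<^bsub>M\<^esub> (r \<odot>\<^bsub>M\<^esub> x) \<in> module_span R M ?T"
          using Jspan[OF j] r submoduleE(4)[OF spT] by simp
      qed
    qed
  qed
  then show "x \<in> N" using mem_cyclic_submodule[OF x] by blast
qed

text \<open>If \<open>C = {x. a x \<in> N}\<close> is strictly larger than \<open>N\<close>, it has finitely many generators up to closure. Their
  multiples by \<open>a\<close> generate \<open>a C = N \<inter> a M\<close> up to closure, so \<open>N\<close> absorbs \<open>a M\<close>.\<close>

lemma maximal_smult_cases:
  assumes a: "a \<in> carrier R"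
  shows "(\<forall>x\<in>carrier M. a \<odot>\<^bsub>M\<^esub> x \<in> N) \<or> (\<forall>x\<in>carrier M. a \<odot>\<^bsub>M\<^esub> x \<in> N \<longrightarrow> x \<in> N)"
proof (rule disjCI)
  note Ns = maximal_submodule
  let ?C = "{x \<in> carrier M. a \<odot>\<^bsub>M\<^esub> x \<in> N}"
  assume "\<not> (\<forall>x\<in>carrier M. a \<odot>\<^bsub>M\<^esub> x \<in> N \<longrightarrow> x \<in> N)"
  moreover have "N \<subseteq> ?C" using submoduleE(1,4)[OF Ns] a by blast
  ultimately have "N \<subset> ?C" by blast
  moreover have "submodule ?C R M"
    by (rule submodule_vimage[OF module_axioms module_axioms smult_linear[OF a] Ns])
  ultimately have "w_fg R M ?C" using max by (simp add: maximal_non_w_fg_def)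
  then obtain S where S: "finite S" "S \<subseteq> ?C" "?C \<subseteq> GV_closure R M (module_span R M S)" by (rule w_fgE)
  let ?T = "(\<lambda>s. a \<odot>\<^bsub>M\<^esub> s) ` S"
  have TN: "?T \<subseteq> N" using S(2) by blast
  have spT: "submodule (module_span R M ?T) R M"
    by (rule module_span_submodule) (use TN submoduleE(1)[OF Ns] in blast)
  have "module_span R M S \<subseteq> {x \<in> carrier M. a \<odot>\<^bsub>M\<^esub> x \<in> module_span R M ?T}"
    by (rule module_span_minimal[OF submodule_vimage[OF module_axioms module_axioms smult_linear[OF a] spT]])
       (use S(2) module_span_superset[of ?T] in blast)
  then have a_span: "a \<odot>\<^bsub>M\<^esub> y \<in> module_span R M ?T" if "y \<in> module_span R M S" for y using that by blast
  have "(\<lambda>x. a \<odot>\<^bsub>M\<^esub> x) ` carrier M \<subseteq> N"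
  proof (rule maximal_absorbs[OF _ _ TN])
    show "submodule ((\<lambda>x. a \<odot>\<^bsub>M\<^esub> x) ` carrier M) R M"
      by (rule submodule_image[OF module_axioms module_axioms smult_linear[OF a] carrier_is_submodule])
    show "finite ?T" using S(1) by simp
    show "N \<inter> (\<lambda>x. a \<odot>\<^bsub>M\<^esub> x) ` carrier M \<subseteq> GV_closure R M (module_span R M ?T)"
    proof clarify
      fix x assume x: "x \<in> carrier M" and "a \<odot>\<^bsub>M\<^esub> x \<in> N"
      then have "x \<in> GV_closure R M (module_span R M S)" using S(3) by blast
      then obtain J where J: "GV_ideal R J" and Jx: "\<And>j. j \<in> J \<Longrightarrow> j \<odot>\<^bsub>M\<^esub> x \<in> module_span R M S"
        by (rule GV_closureE) blast
      show "a \<odot>\<^bsub>M\<^esub> x \<in> GV_closure R M (module_span R M ?T)"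
      proof (rule GV_closureI[OF _ J])
        show "a \<odot>\<^bsub>M\<^esub> x \<in> carrier M" using a x by simp
        fix j assume j: "j \<in> J"
        have "j \<in> carrier R" using ideal.Icarr[OF R.GV_ideal_imp_ideal[OF J] j] .
        then have "j \<odot>\<^bsub>M\<^esub> (a \<odot>\<^bsub>M\<^esub> x) = a \<odot>\<^bsub>M\<^esub> (j \<odot>\<^bsub>M\<^esub> x)" using a x by (metis smult_assoc1 R.m_comm)
        then show "j \<odot>\<^bsub>M\<^esub> (a \<odot>\<^bsub>M\<^esub> x) \<in> module_span R M ?T" using a_span[OF Jx[OF j]] by simp
      qed
    qed
  qed
  then show "\<forall>x\<in>carrier M. a \<odot>\<^bsub>M\<^esub> x \<in> N" by blast
qed

lemma maximal_colon_prime_w_ideal: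
  assumes proper: "N \<noteq> carrier M"
  shows "prime_w_ideal R {r \<in> carrier R. \<forall>x\<in>carrier M. r \<odot>\<^bsub>M\<^esub> x \<in> N}" (is "prime_w_ideal R ?p")
  unfolding prime_w_ideal_def
proof
  note Ns = maximal_submodule
  have "?p = \<Inter>(insert (carrier R) ((\<lambda>x. {r \<in> carrier R. r \<odot>\<^bsub>M\<^esub> x \<in> N}) ` carrier M))" by blast
  also have "ideal \<dots> R"
    by (rule R.i_Intersect) (use colon_ideal[OF Ns] R.oneideal in auto)
  finally have pi: "ideal ?p R" .
  show "primeideal ?p R"
  proof (rule primeidealI[OF pi R.is_cring])
    show "carrier R \<noteq> ?p"
    proof
      assume "carrier R = ?p"
      then have "\<one> \<in> ?p" by (metis R.one_closed)
      then have "carrier M \<subseteq> N" by auto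
      then show False using proper submoduleE(1)[OF Ns] by blast
    qed
    fix a b assume a: "a \<in> carrier R" and b: "b \<in> carrier R" and ab: "a \<otimes> b \<in> ?p"
    show "a \<in> ?p \<or> b \<in> ?p"
    proof (rule disjCI)
      assume "b \<notin> ?p"
      then have div: "\<forall>x\<in>carrier M. b \<odot>\<^bsub>M\<^esub> x \<in> N \<longrightarrow> x \<in> N" using maximal_smult_cases[OF b] b by blast
      have "a \<odot>\<^bsub>M\<^esub> x \<in> N" if x: "x \<in> carrier M" for x
      proof -
        have "(b \<otimes> a) \<odot>\<^bsub>M\<^esub> x \<in> N" using ab x R.m_comm[OF a b] by simp
        then show ?thesis using div a b x by (simp add: smult_assoc1)
      qed
      then show "a \<in> ?p" using a by simp
    qed
  qed
  have "r \<in> ?p" if "r \<in> GV_closure R (ring_as_module R) ?p" for r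
  proof -
    from that obtain J where "r \<in> carrier (ring_as_module R)" and J: "GV_ideal R J"
      and Jr: "\<And>j. j \<in> J \<Longrightarrow> j \<odot>\<^bsub>ring_as_module R\<^esub> r \<in> ?p" by (rule GV_closureE) blast
    then have r: "r \<in> carrier R" by simp
    have "r \<odot>\<^bsub>M\<^esub> x \<in> N" if x: "x \<in> carrier M" for x
    proof -
      have "r \<odot>\<^bsub>M\<^esub> x \<in> GV_closure R M N"
      proof (rule GV_closureI[OF _ J])
        fix j assume j: "j \<in> J"
        have "j \<in> carrier R" using ideal.Icarr[OF R.GV_ideal_imp_ideal[OF J] j] .
        then have "j \<odot>\<^bsub>M\<^esub> (r \<odot>\<^bsub>M\<^esub> x) = (j \<otimes> r) \<odot>\<^bsub>M\<^esub> x" using r x by (simp add: smult_assoc1)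
        then show "j \<odot>\<^bsub>M\<^esub> (r \<odot>\<^bsub>M\<^esub> x) \<in> N" using Jr[OF j] x by simp
      qed (use r x in simp)
      then show ?thesis using maximal_GV_closed by blast
    qed
    then show ?thesis using r by simp
  qed
  then show "w_ideal R ?p" unfolding R.w_ideal_iff using pi by blast
qed

end

lemma ideal_smult_submodule:
  assumes "I \<subseteq> carrier R"
  shows "submodule (ideal_smult R I M) R M"
  unfolding ideal_smult_def
  by (rule submodule_Inter) (use assms carrier_is_submodule in auto)

lemma ideal_smult_minimal:
  "submodule N R M \<Longrightarrow> (\<And>a x. a \<in> I \<Longrightarrow> x \<in> carrier M \<Longrightarrow> a \<odot>\<^bsub>M\<^esub> x \<in> N) \<Longrightarrow> ideal_smult R I M \<subseteq> N"
  unfolding ideal_smult_def by blast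

lemma ideal_smult_mem:
  "a \<in> I \<Longrightarrow> x \<in> carrier M \<Longrightarrow> a \<odot>\<^bsub>M\<^esub> x \<in> ideal_smult R I M"
  unfolding ideal_smult_def by blast

lemma ideal_smult_subset_prime_saturation:
  assumes p: "primeideal \<pp> R"
  shows "ideal_smult R \<pp> M \<subseteq> prime_saturation R M \<pp>"
proof
  interpret p: primeideal \<pp> R by fact
  fix x assume x: "x \<in> ideal_smult R \<pp> M"
  have "submodule (ideal_smult R \<pp> M) R M" by (rule ideal_smult_submodule[OF p.a_subset])
  then have xM: "x \<in> carrier M" using submoduleE(1) x by blast
  have "\<one> \<in> carrier R - \<pp>" using p.I_notcarr p.one_imp_carrier by auto
  moreover have "\<one> \<odot>\<^bsub>M\<^esub> x \<in> ideal_smult R \<pp> M" using x xM by simp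
  ultimately show "x \<in> prime_saturation R M \<pp>" using xM unfolding prime_saturation_def by blast
qed

text \<open>With \<open>\<pp> = (N : M)\<close> for a maximal \<open>N\<close>, multiplication by elements outside \<open>\<pp>\<close> is injective modulo \<open>N\<close>. This
  gives both \<open>M(\<pp>) \<subseteq> N\<close> and, for \<open>x \<notin> N\<close>, that \<open>r x \<in> N\<close> only for \<open>r \<in> \<pp>\<close>. Hence \<open>N \<inter> R x\<close> lies in the
  submodule \<open>P\<close> given for \<open>\<pp>\<close>.\<close>

lemma w_fg_submodules_if_primes:
  assumes fg: "w_fg R M (carrier M)"
    and primes: "\<And>\<pp>. prime_w_ideal R \<pp> \<Longrightarrow> Ann R M \<subseteq> \<pp> \<Longrightarrow>
      \<exists>N. submodule N R M \<and> w_fg R M N \<and> ideal_smult R \<pp> M \<subseteq> N \<and> N \<subseteq> prime_saturation R M \<pp>"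
    and K: "submodule K R M"
  shows "w_fg R M K"
proof (rule ccontr)
  assume "\<not> w_fg R M K"
  then obtain N where max: "maximal_non_w_fg N" using ex_maximal_non_w_fg[OF K] by blast
  note Ns = maximal_submodule[OF max]
  note NM = submoduleE(1)[OF Ns]
  have proper: "N \<noteq> carrier M" using fg max by (auto simp: maximal_non_w_fg_def)
  define \<pp> where "\<pp> = {r \<in> carrier R. \<forall>x\<in>carrier M. r \<odot>\<^bsub>M\<^esub> x \<in> N}"
  have p: "prime_w_ideal R \<pp>" unfolding \<pp>_def by (rule maximal_colon_prime_w_ideal[OF max proper])
  have div: "x \<in> N" if "a \<in> carrier R - \<pp>" "x \<in> carrier M" "a \<odot>\<^bsub>M\<^esub> x \<in> N" for a x
    using maximal_smult_cases[OF max, of a] that unfolding \<pp>_def by blast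
  have "Ann R M \<subseteq> \<pp>" using submodule_zero[OF Ns] by (auto simp: Ann_def \<pp>_def)
  then obtain P where P: "submodule P R M" "w_fg R M P" "ideal_smult R \<pp> M \<subseteq> P" "P \<subseteq> prime_saturation R M \<pp>"
    using primes[OF p] by blast
  have "ideal_smult R \<pp> M \<subseteq> N" by (rule ideal_smult_minimal[OF Ns]) (simp add: \<pp>_def)
  then have PN: "P \<subseteq> N" using P(4) div unfolding prime_saturation_def by blast
  obtain T where T: "finite T" "T \<subseteq> P" "P \<subseteq> GV_closure R M (module_span R M T)" using P(2) by (rule w_fgE)
  obtain x where x: "x \<in> carrier M" "x \<notin> N" using proper NM by blast
  have "(\<lambda>r. r \<odot>\<^bsub>M\<^esub> x) ` carrier R \<subseteq> N"
  proof (rule maximal_absorbs[OF max cyclic_submodule[OF x(1)] T(1)])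
    show "T \<subseteq> N" using T(2) PN by blast
    show "N \<inter> (\<lambda>r. r \<odot>\<^bsub>M\<^esub> x) ` carrier R \<subseteq> GV_closure R M (module_span R M T)"
    proof clarify
      fix r assume r: "r \<in> carrier R" and rx: "r \<odot>\<^bsub>M\<^esub> x \<in> N"
      then have "r \<in> \<pp>" using div x by blast
      then have "r \<odot>\<^bsub>M\<^esub> x \<in> P" using ideal_smult_mem x(1) P(3) by blast
      then show "r \<odot>\<^bsub>M\<^esub> x \<in> GV_closure R M (module_span R M T)" using T(3) by blast
    qed
  qed
  then show False using mem_cyclic_submodule[OF x(1)] x(2) by blast
qed

end

section \<open>The Cohen-type theorem\<close>

theorem theorem3p2:
  fixes R :: "('a, 'b) ring_scheme" and M :: "('a, 'm, 'c) module_scheme"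
  assumes "module R M"
    and "GV_torsion_free R M"
    and "w_finite_type R M"
  shows "w_Noetherian R M \<longleftrightarrow>
    (\<forall>\<pp>. prime_w_ideal R \<pp> \<and> Ann R M \<subseteq> \<pp> \<longrightarrow>
      (\<exists>N. submodule N R M \<and> w_finite_type R (M\<lparr>carrier := N\<rparr>) \<and>
           ideal_smult R \<pp> M \<subseteq> N \<and> N \<subseteq> prime_saturation R M \<pp>))"
proof
  interpret module R M by fact
  assume noeth: "w_Noetherian R M"
  show "\<forall>\<pp>. prime_w_ideal R \<pp> \<and> Ann R M \<subseteq> \<pp> \<longrightarrow>
      (\<exists>N. submodule N R M \<and> w_finite_type R (M\<lparr>carrier := N\<rparr>) \<and>
           ideal_smult R \<pp> M \<subseteq> N \<and> N \<subseteq> prime_saturation R M \<pp>)"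
  proof (intro allI impI)
    fix \<pp> assume "prime_w_ideal R \<pp> \<and> Ann R M \<subseteq> \<pp>"
    then have p: "primeideal \<pp> R" by (simp add: prime_w_ideal_def)
    then interpret p: primeideal \<pp> R .
    have "submodule (ideal_smult R \<pp> M) R M" by (rule ideal_smult_submodule[OF p.a_subset])
    then show "\<exists>N. submodule N R M \<and> w_finite_type R (M\<lparr>carrier := N\<rparr>) \<and>
           ideal_smult R \<pp> M \<subseteq> N \<and> N \<subseteq> prime_saturation R M \<pp>"
      using noeth ideal_smult_subset_prime_saturation[OF p]
      by (intro exI[of _ "ideal_smult R \<pp> M"]) (simp add: w_Noetherian_def)
  qed
next
  interpret module R M by fact
  assume primes: "\<forall>\<pp>. prime_w_ideal R \<pp> \<and> Ann R M \<subseteq> \<pp> \<longrightarrow>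
      (\<exists>N. submodule N R M \<and> w_finite_type R (M\<lparr>carrier := N\<rparr>) \<and>
           ideal_smult R \<pp> M \<subseteq> N \<and> N \<subseteq> prime_saturation R M \<pp>)"
  have "w_fg R M (carrier M)"
    using assms(3) w_finite_type_iff[OF carrier_is_submodule] by simp
  moreover have "\<exists>N. submodule N R M \<and> w_fg R M N \<and>
      ideal_smult R \<pp> M \<subseteq> N \<and> N \<subseteq> prime_saturation R M \<pp>"
    if "prime_w_ideal R \<pp>" "Ann R M \<subseteq> \<pp>" for \<pp>
    using primes that w_finite_type_iff by blast
  ultimately have "w_fg R M K" if "submodule K R M" for K
    using w_fg_submodules_if_primes that by blast
  then show "w_Noetherian R M" unfolding w_Noetherian_def using w_finite_type_iff by blast
qed

end
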